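(* Let $X$ be a complex Hilbert space and let $H$ be an m-accretive operator in $X$ with domain $D(H)$. Put $$\Psi(H)=\inf\{\|(H-i\lambda)f\| : f\in D(H),\ \lambda\in\mathbb{R},\ \|f\|=1\}.$$ Then $\|e^{-tH}\|\le e^{-t\Psi(H)+\pi/2}$ for all $t\ge 0$.
   Context: A closed (possibly unbounded) linear operator $H$ in a complex Hilbert space $X$ is called m-accretive if the left open half-plane $\{z\in\mathbb{C}:\operatorname{Re} z<0\}$ is contained in the resolvent set of $H$ and, for every $\lambda\in\mathbb{C}$ with $\operatorname{Re}\lambda>0$, $(H+\lambda)^{-1}$ is a bounded linear operator on $X$ with $\|(H+\lambda)^{-1}\|\le(\operatorname{Re}\lambda)^{-1}$. It is a standard fact that such an $H$ is densely defined and accretive ($\operatorname{Re}\langle Hf,f\rangle\ge 0$ for $f\in D(H)$), and that $-H$ generates a strongly continuous semigroup on $X$, denoted $e^{-tH}$, $t\ge 0$. The norm of $e^{-tH}$ is the operator norm on $X$. *)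

theory Defs
  imports "HOL-Analysis.Analysis"
begin

text \<open>Complex Hilbert spaces. The inner product is linear in the first argument. The last axiom
  identifies the real inner product, and hence the norm and the topology, of the type class
  \<^class>\<open>real_inner\<close> with those induced by the complex one.\<close>

class complex_inner = real_inner +
  fixes scaleC :: "complex \<Rightarrow> 'a \<Rightarrow> 'a"  (infixr "*\<^sub>C" 75)
    and cinner :: "'a \<Rightarrow> 'a \<Rightarrow> complex"
  assumes scaleC_add_right: "c *\<^sub>C (x + y) = c *\<^sub>C x + c *\<^sub>C y"
    and scaleC_add_left: "(c + d) *\<^sub>C x = c *\<^sub>C x + d *\<^sub>C x"
    and scaleC_scaleC: "c *\<^sub>C d *\<^sub>C x = (c * d) *\<^sub>C x"
    and scaleC_of_real: "complex_of_real r *\<^sub>C x = r *\<^sub>R x"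
    and cinner_commute: "cinner x y = cnj (cinner y x)"
    and cinner_add_left: "cinner (x + y) z = cinner x z + cinner y z"
    and cinner_scaleC_left: "cinner (c *\<^sub>C x) y = c * cinner x y"
    and inner_eq_Re_cinner: "x \<bullet> y = Re (cinner x y)"

class complex_hilbert = complex_inner + complete_space

instantiation complex :: complex_hilbert
begin

definition scaleC_complex :: "complex \<Rightarrow> complex \<Rightarrow> complex"
  where "scaleC_complex c x = c * x"

definition cinner_complex :: "complex \<Rightarrow> complex \<Rightarrow> complex"
  where "cinner_complex x y = x * cnj y"

instance
  by standard
    (simp_all add: scaleC_complex_def cinner_complex_def inner_complex_def algebra_simps
      scaleR_conv_of_real)

end

definition bounded_clinear :: "('a::complex_inner \<Rightarrow> 'a) \<Rightarrow> bool"
  where "bounded_clinear T \<longleftrightarrow> bounded_linear T \<and> (\<forall>c x. T (c *\<^sub>C x) = c *\<^sub>C T x)"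

text \<open>An unbounded operator is given by its domain \<open>D\<close> and a total function \<open>H\<close> of which only the
  values on \<open>D\<close> are relevant.\<close>

definition linear_operator :: "'a::complex_inner set \<Rightarrow> ('a \<Rightarrow> 'a) \<Rightarrow> bool"
  where "linear_operator D H \<longleftrightarrow>
    0 \<in> D \<and>
    (\<forall>f\<in>D. \<forall>g\<in>D. f + g \<in> D \<and> H (f + g) = H f + H g) \<and>
    (\<forall>c. \<forall>f\<in>D. c *\<^sub>C f \<in> D \<and> H (c *\<^sub>C f) = c *\<^sub>C H f)"

definition closed_operator :: "'a::complex_inner set \<Rightarrow> ('a \<Rightarrow> 'a) \<Rightarrow> bool"
  where "closed_operator D H \<longleftrightarrow> linear_operator D H \<and> closed {(f, H f) | f. f \<in> D}"

definition shifted_inverse :: "'a::complex_inner set \<Rightarrow> ('a \<Rightarrow> 'a) \<Rightarrow> complex \<Rightarrow> 'a \<Rightarrow> 'a"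
  where "shifted_inverse D H z = inv_into D (\<lambda>f. H f + z *\<^sub>C f)"

definition resolvent_set :: "'a::complex_inner set \<Rightarrow> ('a \<Rightarrow> 'a) \<Rightarrow> complex set"
  where "resolvent_set D H =
    {z. bij_betw (\<lambda>f. H f - z *\<^sub>C f) D UNIV \<and>
        bounded_clinear (inv_into D (\<lambda>f. H f - z *\<^sub>C f))}"

definition m_accretive :: "'a::complex_hilbert set \<Rightarrow> ('a \<Rightarrow> 'a) \<Rightarrow> bool"
  where "m_accretive D H \<longleftrightarrow>
    closed_operator D H \<and>
    {z. Re z < 0} \<subseteq> resolvent_set D H \<and>
    (\<forall>z. Re z > 0 \<longrightarrow>
      bounded_clinear (shifted_inverse D H z) \<and> onorm (shifted_inverse D H z) \<le> inverse (Re z))"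

text \<open>Only the values \<open>S t\<close> for \<open>t \<ge> 0\<close> are relevant.\<close>

definition C0_semigroup :: "(real \<Rightarrow> 'a::complex_inner \<Rightarrow> 'a) \<Rightarrow> bool"
  where "C0_semigroup S \<longleftrightarrow>
    (\<forall>t\<ge>0. bounded_clinear (S t)) \<and>
    (\<forall>x. S 0 x = x) \<and>
    (\<forall>s\<ge>0. \<forall>t\<ge>0. \<forall>x. S (s + t) x = S s (S t x)) \<and>
    (\<forall>x. continuous_on {0..} (\<lambda>t. S t x))"

definition is_generator :: "(real \<Rightarrow> 'a::complex_inner \<Rightarrow> 'a) \<Rightarrow> 'a set \<Rightarrow> ('a \<Rightarrow> 'a) \<Rightarrow> bool"
  where "is_generator S D A \<longleftrightarrow>
    (\<forall>x y. ((\<lambda>h. (S h x - x) /\<^sub>R h) \<longlongrightarrow> y) (at_right 0) \<longleftrightarrow> x \<in> D \<and> y = A x)"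

text \<open>\<open>exp_semigroup D H t\<close> is the operator \<open>e\<^sup>-\<^sup>t\<^sup>H\<close>: the value at time \<open>t\<close> of the strongly continuous
  semigroup generated by \<open>-H\<close>. The description ranges over the operator at the single time \<open>t\<close>
  because a semigroup is determined by its generator only for times \<open>t \<ge> 0\<close>.\<close>

definition exp_semigroup :: "'a::complex_hilbert set \<Rightarrow> ('a \<Rightarrow> 'a) \<Rightarrow> real \<Rightarrow> 'a \<Rightarrow> 'a"
  where "exp_semigroup D H t =
    (THE T. \<exists>S. C0_semigroup S \<and> is_generator S D (\<lambda>f. - H f) \<and> T = S t)"

definition Psi :: "'a::complex_hilbert set \<Rightarrow> ('a \<Rightarrow> 'a) \<Rightarrow> real"
  where "Psi D H =
    Inf {norm (H f - (\<i> * complex_of_real s) *\<^sub>C f) | f s. f \<in> D \<and> norm f = 1}"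

end

theory Submission
  imports Defs
begin

text \<open>
  Write \<open>f(t) = e\<^sup>-\<^sup>t\<^sup>Hx\<close> with \<open>x\<close> in the domain and \<open>p = \<Psi>(H)\<close>. If \<open>w\<close> is a scalar function vanishing at
  both ends of an interval \<open>[0, M]\<close>, then \<open>u = wf\<close> satisfies \<open>u' + Hu = w'f\<close>. On the Fourier side \<open>d/dt\<close>
  becomes a purely imaginary number, so Parseval gives \<open>p\<^sup>2 \<integral> |wf|\<^sup>2 \<le> \<integral> |w'f|\<^sup>2\<close>. This is obtained from
  the finite Fourier transform of samples of \<open>u\<close>, with \<open>d/dt\<close> replaced by a symmetric difference
  quotient, whose symbol is still purely imaginary. Since \<open>|f|\<close> is nonincreasing, choosing \<open>w\<close>
  proportional to \<open>sin pt\<close> up to \<open>pt = \<pi>/4\<close>, then to \<open>e\<^sup>p\<^sup>t\<close>, and to \<open>cos p(t - T)\<close> from \<open>pt = pT - \<pi>/4\<close>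
  until its zero at \<open>pt = pT + \<pi>/2\<close> yields \<open>|f(T)|\<^sup>2 \<le> e\<^sup>-\<^sup>2\<^sup>p\<^sup>T\<^sup>+\<^sup>\<pi> |x|\<^sup>2\<close>. When \<open>pT < \<pi>/2\<close> contractivity suffices.
\<close>

subsection \<open>Complex inner products and the finite Fourier transform\<close>

text \<open>The finite transform treats an orbit, cut off to a bounded interval, as periodic. The
  only price is the one difference quotient that straddles the junction; it is bounded, so its
  contribution disappears with the mesh.

  The pieces of \<open>w\<close> come from \<open>w'^2 - p^2 w^2\<close>. This is
  \<open>p^2 cos 2pt\<close> on the first piece, 0 on the exponential and
  \<open>-p^2 C^2 cos 2p(t - T)\<close> on the last, where matching values and slopes forces
  \<open>C = e^(pT - pi/2)\<close>. Freezing the nonincreasing \<open>|f|^2\<close> at a suitable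
  time on each stretch makes every integral elementary. Beyond \<open>T\<close> the cosine has mean
  zero over \<open>[T, T + pi/(2p)]\<close> and is positive first, so that stretch costs nothing.
  What survives is \<open>p |x|^2 / 2\<close> against \<open>p C^2 |f(T)|^2 / 2\<close>.

  The operator \<open>e^-tH\<close> is given by a definite description, so a semigroup has to be
  built and proved unique before any estimate applies. Density of the domain is extracted from
  accretivity and the closed graph.\<close>

lemma scaleC_zero_left [simp]: "0 *\<^sub>C (x::'a::complex_inner) = 0"
  using scaleC_of_real[of 0 x] by simp

lemma scaleC_one [simp]: "1 *\<^sub>C (x::'a::complex_inner) = x"
  using scaleC_of_real[of 1 x] by simp

lemma scaleC_zero_right [simp]: "c *\<^sub>C (0::'a::complex_inner) = 0"
  using scaleC_add_right[of c 0 "0::'a"] by simp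

lemma scaleC_minus_right [simp]: "c *\<^sub>C (- x::'a::complex_inner) = - (c *\<^sub>C x)"
  using scaleC_add_right[of c x "-x"] by (simp add: eq_neg_iff_add_eq_0 add.commute)

lemma scaleC_minus_left [simp]: "(- c) *\<^sub>C (x::'a::complex_inner) = - (c *\<^sub>C x)"
  using scaleC_add_left[of c "-c" x] by (simp add: eq_neg_iff_add_eq_0 add.commute)

lemma scaleC_diff_right: "c *\<^sub>C (x - y::'a::complex_inner) = c *\<^sub>C x - c *\<^sub>C y"
  using scaleC_add_right[of c x "-y"] by simp

lemma scaleC_diff_left: "(c - d) *\<^sub>C (x::'a::complex_inner) = c *\<^sub>C x - d *\<^sub>C x"
  using scaleC_add_left[of c "-d" x] by simp

lemma scaleC_scaleR: "c *\<^sub>C (r *\<^sub>R x::'a::complex_inner) = r *\<^sub>R (c *\<^sub>C x)"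
  by (simp add: scaleC_of_real[symmetric] scaleC_scaleC mult.commute)

lemma cinner_scaleC_right: "cinner (x::'a::complex_inner) (c *\<^sub>C y) = cnj c * cinner x y"
  by (metis cinner_commute cinner_scaleC_left complex_cnj_mult)

lemma norm_scaleC: "norm (c *\<^sub>C x::'a::complex_inner) = cmod c * norm x"
proof (rule power2_eq_imp_eq)
  have "(norm (c *\<^sub>C x))\<^sup>2 = Re (c * cnj c * cinner x x)"
    by (simp only: power2_norm_eq_inner inner_eq_Re_cinner cinner_scaleC_left cinner_scaleC_right
        mult_ac)
  also have "\<dots> = Re (of_real ((cmod c)\<^sup>2) * cinner x x)"
    by (simp only: complex_norm_square mult_ac)
  also have "Re (of_real ((cmod c)\<^sup>2) * cinner x x) = (cmod c)\<^sup>2 * Re (cinner x x)"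
    by simp
  also have "\<dots> = (cmod c * norm x)\<^sup>2"
    by (simp add: power2_norm_eq_inner inner_eq_Re_cinner power_mult_distrib)
  finally show "(norm (c *\<^sub>C x))\<^sup>2 = (cmod c * norm x)\<^sup>2" .
qed auto

lemma bounded_linear_scaleC: "bounded_linear ((*\<^sub>C) c :: 'a::complex_inner \<Rightarrow> 'a)"
  by (rule bounded_linear_intro[where K="cmod c"])
    (auto simp: scaleC_add_right scaleC_scaleR norm_scaleC mult.commute)

lemmas tendsto_scaleC = bounded_linear.tendsto[OF bounded_linear_scaleC]

lemma inner_scaleC_scaleC:
  "(c *\<^sub>C x) \<bullet> (d *\<^sub>C y::'a::complex_inner) = ((c * cnj d) *\<^sub>C x) \<bullet> y"
  by (simp add: inner_eq_Re_cinner cinner_scaleC_left cinner_scaleC_right mult_ac)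

lemma sum_scaleC_left: "(\<Sum>i\<in>A. c i *\<^sub>C (x::'a::complex_inner)) = (\<Sum>i\<in>A. c i) *\<^sub>C x"
  by (induction A rule: infinite_finite_induct) (auto simp: scaleC_add_left)

lemma sum_scaleC_right: "c *\<^sub>C (\<Sum>i\<in>A. x i) = (\<Sum>i\<in>A. c *\<^sub>C (x i::'a::complex_inner))"
  by (induction A rule: infinite_finite_induct) (auto simp: scaleC_add_right)

definition root_of_unity :: "nat \<Rightarrow> nat \<Rightarrow> complex"
  where "root_of_unity n k = cis (2 * pi * real k / real n)"

text \<open>Each summand is \<open>w ^ k\<close> for the root of unity \<open>w\<close> with angle 2
  pi (j - l) / n, so the sum is geometric. It vanishes unless \<open>w = 1\<close>, which would make
  n divide j - l; that is impossible for distinct indices below n.\<close>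

lemma sum_roots_of_unity:
  assumes "j < n" "l < n"
  shows "(\<Sum>k<n. root_of_unity n k ^ j * cnj (root_of_unity n k ^ l)) = (if j = l then of_nat n else 0)"
proof -
  define w where "w = cis (2 * pi * (real j - real l) / real n)"
  have eq: "root_of_unity n k ^ j * cnj (root_of_unity n k ^ l) = w ^ k" for k
  proof -
    have "root_of_unity n k ^ j = cis (real j * (2 * pi * real k / real n))"
      by (simp add: root_of_unity_def Complex.DeMoivre)
    moreover have "cnj (root_of_unity n k ^ l) = cis (- (real l * (2 * pi * real k / real n)))"
      by (simp add: root_of_unity_def Complex.DeMoivre cis_cnj del: complex_cnj_power)
    moreover have "w ^ k = cis (real k * (2 * pi * (real j - real l) / real n))"
      by (simp add: w_def Complex.DeMoivre)
    moreover have "real j * (2 * pi * real k / real n) + - (real l * (2 * pi * real k / real n))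
        = real k * (2 * pi * (real j - real l) / real n)"
      by (simp add: diff_divide_distrib right_diff_distrib mult_ac)
    ultimately show ?thesis by (simp add: cis_mult)
  qed
  show ?thesis
  proof (cases "j = l")
    case True
    then show ?thesis unfolding eq by (simp add: w_def)
  next
    case False
    have "w \<noteq> 1"
    proof
      assume "w = 1"
      then obtain m :: int where m: "2 * pi * (real j - real l) / real n = of_int (2 * m) * pi"
        unfolding w_def cis_conv_exp exp_eq_1 by auto
      then have "2 * pi * (real j - real l) = 2 * pi * (of_int m * real n)"
        using assms by (simp add: field_simps)
      then have "real j - real l = of_int m * real n"
        by (simp only: mult_cancel_left) simp
      then have "real_of_int (int j - int l) = real_of_int (m * int n)"
        by simp
      then have "int j - int l = m * int n" by (simp only: of_int_eq_iff)
      then have "int n dvd int j - int l" by simp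
      moreover have "\<bar>int j - int l\<bar> < int n" using assms by auto
      ultimately have "int j - int l = 0" using dvd_imp_le_int[of "int j - int l" "int n"] by linarith
      then show False using False by simp
    qed
    moreover have "w ^ n = 1"
    proof -
      have "w ^ n = cis (2 * pi * of_int (int j - int l))"
        using assms by (simp add: w_def Complex.DeMoivre)
      then show ?thesis by (simp add: cis_multiple_2pi)
    qed
    ultimately show ?thesis unfolding eq using False by (simp add: geometric_sum)
  qed
qed

text \<open>Expand both copies, move all scalars into the left argument of the real inner product
  and sum over the frequency \<open>k\<close> innermost; orthogonality of the characters leaves the
  diagonal.\<close>

lemma parseval_dft:
  fixes u :: "nat \<Rightarrow> 'a::complex_inner"
  shows "(\<Sum>k<n. (norm (\<Sum>j<n. root_of_unity n k ^ j *\<^sub>C u j))\<^sup>2) = real n * (\<Sum>j<n. (norm (u j))\<^sup>2)"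
proof -
  have "(\<Sum>k<n. (norm (\<Sum>j<n. root_of_unity n k ^ j *\<^sub>C u j))\<^sup>2)
     = (\<Sum>k<n. \<Sum>l<n. \<Sum>j<n. ((root_of_unity n k ^ j * cnj (root_of_unity n k ^ l)) *\<^sub>C u j) \<bullet> u l)"
    by (simp only: power2_norm_eq_inner inner_sum_left inner_sum_right inner_scaleC_scaleC)
  also have "\<dots> = (\<Sum>k<n. \<Sum>j<n. \<Sum>l<n. ((root_of_unity n k ^ j * cnj (root_of_unity n k ^ l)) *\<^sub>C u j) \<bullet> u l)"
    by (intro sum.cong refl sum.swap)
  also have "\<dots> = (\<Sum>j<n. \<Sum>k<n. \<Sum>l<n. ((root_of_unity n k ^ j * cnj (root_of_unity n k ^ l)) *\<^sub>C u j) \<bullet> u l)"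
    by (rule sum.swap)
  also have "\<dots> = (\<Sum>j<n. \<Sum>l<n. \<Sum>k<n. ((root_of_unity n k ^ j * cnj (root_of_unity n k ^ l)) *\<^sub>C u j) \<bullet> u l)"
    by (intro sum.cong refl sum.swap)
  also have "\<dots> = (\<Sum>j<n. \<Sum>l<n. ((if j = l then of_nat n else 0) *\<^sub>C u j) \<bullet> u l)"
    by (intro sum.cong refl, simp only: inner_sum_left[symmetric] sum_scaleC_left)
      (subst sum_roots_of_unity, auto)
  also have "\<dots> = (\<Sum>j<n. \<Sum>l<n. if j = l then (of_nat n *\<^sub>C u j) \<bullet> u l else 0)"
    by (intro sum.cong refl) auto
  also have "\<dots> = (\<Sum>j<n. real n * (norm (u j))\<^sup>2)"
    using scaleC_of_real[of "real n", where ?'a='a] by (simp add: power2_norm_eq_inner)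
  finally show ?thesis by (simp add: sum_distrib_left)
qed

text \<open>Vanishing at both ends closes the sequence up to one of period \<open>Suc m\<close>, so
  an index shift becomes multiplication by \<open>z\<close> or its inverse. In the second identity
  the wrapped-around term \<open>u m\<close> has coefficient \<open>z ^ Suc m = 1\<close>.\<close>

lemma dft_shift:
  fixes u :: "nat \<Rightarrow> 'a::complex_inner"
  assumes "z ^ Suc m = 1" and "u 0 = 0" "u (Suc m) = 0"
  shows "(\<Sum>j<Suc m. z ^ j *\<^sub>C u (Suc j)) = inverse z *\<^sub>C (\<Sum>j<Suc m. z ^ j *\<^sub>C u j)"
    and "u m + (\<Sum>j<m. z ^ Suc j *\<^sub>C u j) = z *\<^sub>C (\<Sum>j<Suc m. z ^ j *\<^sub>C u j)"
proof -
  have z: "z \<noteq> 0" using assms(1) by (auto simp: power_0_left)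
  have "(\<Sum>j<Suc m. z ^ j *\<^sub>C u j) = (\<Sum>j<m. z ^ Suc j *\<^sub>C u (Suc j))"
    using assms by (subst sum.lessThan_Suc_shift) simp
  also have "\<dots> = (\<Sum>j<Suc m. z ^ Suc j *\<^sub>C u (Suc j))"
    using assms by simp
  also have "\<dots> = z *\<^sub>C (\<Sum>j<Suc m. z ^ j *\<^sub>C u (Suc j))"
    by (simp only: sum_scaleC_right scaleC_scaleC power_Suc)
  finally show "(\<Sum>j<Suc m. z ^ j *\<^sub>C u (Suc j)) = inverse z *\<^sub>C (\<Sum>j<Suc m. z ^ j *\<^sub>C u j)"
    using z by (simp add: scaleC_scaleC del: sum.lessThan_Suc)
  have "z *\<^sub>C (\<Sum>j<Suc m. z ^ j *\<^sub>C u j) = (\<Sum>j<Suc m. z ^ Suc j *\<^sub>C u j)"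
    by (simp only: sum_scaleC_right scaleC_scaleC power_Suc)
  then show "u m + (\<Sum>j<m. z ^ Suc j *\<^sub>C u j) = z *\<^sub>C (\<Sum>j<Suc m. z ^ j *\<^sub>C u j)"
    using assms(1) by (simp add: add.commute)
qed

text \<open>Serves the uniqueness of the semigroup, where only derivatives from the right are at
  hand. Take the last time at which \<phi> lies below a line of small slope d > 0 through its
  initial value; a right derivative below d produces a later one.\<close>

lemma right_derivative_nonpos_imp_le:
  fixes \<phi> :: "real \<Rightarrow> real"
  assumes cont: "continuous_on {a..b} \<phi>" and "a \<le> b"
    and deriv: "\<And>t. a \<le> t \<Longrightarrow> t < b \<Longrightarrow> \<exists>L\<le>0. ((\<lambda>h. (\<phi> (t + h) - \<phi> t) / h) \<longlongrightarrow> L) (at_right 0)"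
  shows "\<phi> b \<le> \<phi> a"
proof (rule field_le_epsilon)
  fix e :: real assume "e > 0"
  \<comment> \<open>The 1 in the denominator keeps \<open>d\<close> positive when
    \<open>a = b\<close>.\<close>
  define d where "d = e / (b - a + 1)"
  have d: "d > 0" using \<open>e > 0\<close> \<open>a \<le> b\<close> by (simp add: d_def)
  define A where "A = {t\<in>{a..b}. \<phi> t \<le> \<phi> a + d * (t - a)}"
  have "closed A" unfolding A_def
    by (intro continuous_on_closed_Collect_le continuous_intros cont)
  moreover have "A = {a..b} \<inter> A" by (auto simp: A_def)
  ultimately have "compact A" using compact_Int_closed[OF compact_Icc, of A a b] by simp
  moreover have "a \<in> A" using \<open>a \<le> b\<close> by (simp add: A_def)
  ultimately obtain c where c: "c \<in> A" "\<And>t. t \<in> A \<Longrightarrow> t \<le> c"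
    using compact_attains_sup[of A] by auto
  have "c = b"
  proof (rule ccontr)
    assume "c \<noteq> b"
    then have cb: "a \<le> c" "c < b" using c(1) by (auto simp: A_def)
    obtain L where "L \<le> 0" and L: "((\<lambda>h. (\<phi> (c + h) - \<phi> c) / h) \<longlongrightarrow> L) (at_right 0)"
      using deriv[OF cb] by blast
    then have "\<forall>\<^sub>F h in at_right 0. (\<phi> (c + h) - \<phi> c) / h < d"
      using order_tendstoD(2)[OF L, of d] d by auto
    moreover have "\<forall>\<^sub>F h in at_right 0. h \<in> {0<..<b - c}"
      using cb by (intro eventually_at_right_real) auto
    ultimately have "eventually (\<lambda>h. False) (at_right (0::real))"
    proof eventually_elim
      case (elim h)
      then have "\<phi> (c + h) \<le> \<phi> c + d * h" by (simp add: field_simps)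
      also have "\<dots> \<le> \<phi> a + d * (c + h - a)" using c(1) by (simp add: A_def algebra_simps)
      finally have "c + h \<in> A" using elim cb by (simp add: A_def)
      then show False using c(2)[of "c + h"] elim by auto
    qed
    then show False by simp
  qed
  then have "\<phi> b \<le> \<phi> a + d * (b - a)" using c(1) by (simp add: A_def)
  also have "d * (b - a) \<le> e" using \<open>e > 0\<close> \<open>a \<le> b\<close> by (simp add: d_def field_simps)
  finally show "\<phi> b \<le> \<phi> a + e" by simp
qed

subsection \<open>Resolvents of m-accretive operators\<close>

lemma funpow_closed: "(\<And>y. y \<in> A \<Longrightarrow> T y \<in> A) \<Longrightarrow> x \<in> A \<Longrightarrow> (T ^^ k) x \<in> A"
  by (induction k) auto

lemma funpow_contraction:
  fixes T :: "'a::real_normed_vector \<Rightarrow> 'a"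
  assumes "\<And>y. norm (T y) \<le> norm y"
  shows "norm ((T ^^ k) x) \<le> norm x"
  by (induction k) (auto intro: order_trans[OF assms])

text \<open>Local errors add up without amplification because \<open>P\<close> is nonexpansive. They
  need control only on \<open>A\<close>, which the orbit of \<open>Q\<close> does not leave.\<close>

lemma funpow_diff_le:
  fixes P Q :: "'a::real_normed_vector \<Rightarrow> 'a"
  assumes "\<And>y z. norm (P y - P z) \<le> norm (y - z)"
    and "\<And>y. y \<in> A \<Longrightarrow> Q y \<in> A" and "\<And>y. y \<in> A \<Longrightarrow> norm (P y - Q y) \<le> c" and "x \<in> A"
  shows "norm ((P ^^ k) x - (Q ^^ k) x) \<le> real k * c"
proof (induction k)
  case (Suc k)
  have "norm (P ((P ^^ k) x) - Q ((Q ^^ k) x))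
      \<le> norm (P ((P ^^ k) x) - P ((Q ^^ k) x)) + norm (P ((Q ^^ k) x) - Q ((Q ^^ k) x))"
    by (rule order_trans[OF _ norm_triangle_ineq]) simp
  also have "\<dots> \<le> real k * c + c"
    using assms(1)[of "(P ^^ k) x" "(Q ^^ k) x"] Suc assms(3)[OF funpow_closed[of A Q x k]] assms(2,4)
    by fastforce
  finally show ?case by (simp add: algebra_simps)
qed simp

locale m_accretive_operator =
  fixes D :: "'a::complex_hilbert set" and H :: "'a \<Rightarrow> 'a"
  assumes m_accretive: "m_accretive D H"
begin

lemma lin: "linear_operator D H" and closed_graph: "closed {(f, H f) | f. f \<in> D}"
  using m_accretive by (auto simp: m_accretive_def closed_operator_def)

lemma zero_D [simp]: "0 \<in> D"
  and add_D: "f \<in> D \<Longrightarrow> g \<in> D \<Longrightarrow> f + g \<in> D"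
  and H_add: "f \<in> D \<Longrightarrow> g \<in> D \<Longrightarrow> H (f + g) = H f + H g"
  and scaleC_D: "f \<in> D \<Longrightarrow> c *\<^sub>C f \<in> D"
  and H_scaleC: "f \<in> D \<Longrightarrow> H (c *\<^sub>C f) = c *\<^sub>C H f"
  using lin by (auto simp: linear_operator_def)

lemma scaleR_D: "f \<in> D \<Longrightarrow> r *\<^sub>R f \<in> D"
  using scaleC_D[of f "of_real r"] by (simp add: scaleC_of_real)

lemma H_scaleR: "f \<in> D \<Longrightarrow> H (r *\<^sub>R f) = r *\<^sub>R H f"
  using H_scaleC[of f "of_real r"] by (simp add: scaleC_of_real)

lemma H_zero [simp]: "H 0 = 0"
  using H_scaleR[of 0 0] by simp

lemma diff_D: "f \<in> D \<Longrightarrow> g \<in> D \<Longrightarrow> f - g \<in> D"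
  using add_D[of f "(-1) *\<^sub>R g"] scaleR_D[of g "-1"] by simp

lemma H_diff: "f \<in> D \<Longrightarrow> g \<in> D \<Longrightarrow> H (f - g) = H f - H g"
  using H_add[of f "(-1) *\<^sub>R g"] scaleR_D[of g "-1"] H_scaleR[of g "-1"] by simp

lemma sum_D: "(\<And>i. i \<in> A \<Longrightarrow> f i \<in> D) \<Longrightarrow> (\<Sum>i\<in>A. f i) \<in> D"
  by (induction A rule: infinite_finite_induct) (auto simp: add_D)

lemma H_sum: "(\<And>i. i \<in> A \<Longrightarrow> f i \<in> D) \<Longrightarrow> H (\<Sum>i\<in>A. f i) = (\<Sum>i\<in>A. H (f i))"
  by (induction A rule: infinite_finite_induct) (auto simp: sum_D H_add)

lemma graph_closedI:
  assumes "\<And>n. f n \<in> D" "f \<longlonglongrightarrow> x" "(\<lambda>n. H (f n)) \<longlonglongrightarrow> y"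
  shows "x \<in> D \<and> H x = y"
proof -
  have "(\<lambda>n. (f n, H (f n))) \<longlonglongrightarrow> (x, y)" using assms by (intro tendsto_Pair)
  then have "(x, y) \<in> {(f, H f) | f. f \<in> D}"
    by (rule closed_sequentially[OF closed_graph, rotated])
      (simp add: assms(1))
  then show ?thesis by auto
qed

text \<open>(1 + hH)^(-1) is 1/h times the inverse of H + 1/h. Surjectivity comes from -1/h lying in
  the resolvent set, contractivity from the norm bound \<open>h\<close> for that inverse.\<close>

lemma resolvent_equation:
  assumes "h > 0"
  shows "\<exists>f\<in>D. f + h *\<^sub>R H f = y"
    and "f \<in> D \<Longrightarrow> norm f \<le> norm (f + h *\<^sub>R H f)"
proof -
  define z :: complex where "z = of_real (1 / h)"
  have z: "Re z > 0" "Re z = 1 / h" using assms by (auto simp: z_def)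
  have zs: "z *\<^sub>C f = (1 / h) *\<^sub>R f" for f :: 'a unfolding z_def by (rule scaleC_of_real)
  define T where "T = shifted_inverse D H z"
  have "- z \<in> resolvent_set D H" using m_accretive z by (auto simp: m_accretive_def)
  then have bij: "bij_betw (\<lambda>f. H f + z *\<^sub>C f) D UNIV" by (simp add: resolvent_set_def)
  have T: "bounded_linear T" "onorm T \<le> h"
  proof -
    have "bounded_clinear T \<and> onorm T \<le> inverse (Re z)"
      using m_accretive z(1) by (simp add: m_accretive_def T_def)
    then show "bounded_linear T" "onorm T \<le> h" by (auto simp: bounded_clinear_def z(2))
  qed
  have TH: "T (H f + z *\<^sub>C f) = f" if "f \<in> D" for f
    unfolding T_def shifted_inverse_def
    using bij_betw_inv_into_left[OF bij that] by simp
  have "(1 / h) *\<^sub>R y \<in> (\<lambda>f. H f + z *\<^sub>C f) ` D" using bij by (simp add: bij_betw_def)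
  then obtain f where f: "f \<in> D" "(1 / h) *\<^sub>R y = H f + (1 / h) *\<^sub>R f" unfolding zs by (rule imageE)
  have "y = h *\<^sub>R ((1 / h) *\<^sub>R y)" using assms by simp
  also have "\<dots> = f + h *\<^sub>R H f" unfolding f(2) using assms by (simp add: scaleR_add_right)
  finally show "\<exists>f\<in>D. f + h *\<^sub>R H f = y" using f(1) by metis
  show "norm f \<le> norm (f + h *\<^sub>R H f)" if "f \<in> D" for f
  proof -
    have "norm f = norm (T ((1 / h) *\<^sub>R (f + h *\<^sub>R H f)))"
      using TH[OF that] assms by (simp add: zs scaleR_add_right add.commute)
    also have "\<dots> \<le> onorm T * norm ((1 / h) *\<^sub>R (f + h *\<^sub>R H f))" by (rule onorm[OF T(1)])
    also have "\<dots> \<le> h * norm ((1 / h) *\<^sub>R (f + h *\<^sub>R H f))" by (intro mult_right_mono T) auto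
    finally show ?thesis using assms by simp
  qed
qed

text \<open>Squaring \<open>norm f \<le> norm (f + h *\<^sub>R H f)\<close> and dividing by
  \<open>h\<close> leaves a nonnegative expression, affine in \<open>h\<close>, with constant term
  \<open>2 * (H f \<bullet> f)\<close>. Small \<open>h\<close> exposes its sign.\<close>

lemma accretive:
  assumes "f \<in> D"
  shows "H f \<bullet> f \<ge> 0"
proof (rule ccontr)
  assume "\<not> H f \<bullet> f \<ge> 0"
  then have neg: "H f \<bullet> f < 0" by simp
  have ineq: "0 \<le> 2 * (H f \<bullet> f) + h * (norm (H f))\<^sup>2" if "h > 0" for h
  proof -
    have "(norm f)\<^sup>2 \<le> (norm (f + h *\<^sub>R H f))\<^sup>2"
      using resolvent_equation(2)[OF that assms] by (simp add: power_mono)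
    also have "\<dots> = (norm f)\<^sup>2 + h * (2 * (H f \<bullet> f) + h * (norm (H f))\<^sup>2)"
      by (simp add: power2_norm_eq_inner inner_add_left inner_add_right inner_commute[of f "H f"]
          distrib_left)
    finally show ?thesis
      using mult_pos_neg[OF that, of "2 * (H f \<bullet> f) + h * (norm (H f))\<^sup>2"] by linarith
  qed
  \<comment> \<open>Small enough that the term in \<open>h\<close> compensates at most half of the
    negative \<open>2 * (H f \<bullet> f)\<close>.\<close>
  define h where "h = - (H f \<bullet> f) / (1 + (norm (H f))\<^sup>2)"
  have pos: "1 + (norm (H f))\<^sup>2 > 0" by (simp add: add_pos_nonneg)
  then have "h > 0" using neg by (simp add: h_def divide_neg_pos)
  have "h * (norm (H f))\<^sup>2 \<le> h * (1 + (norm (H f))\<^sup>2)" using \<open>h > 0\<close> by simp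
  also have "\<dots> = - (H f \<bullet> f)" using pos by (simp add: h_def)
  finally show False using ineq[OF \<open>h > 0\<close>] neg by linarith
qed

text \<open>The resolvent (1 + hH)^(-1): one implicit Euler step of length \<open>h\<close> for y' =
  -Hy.\<close>

definition J :: "real \<Rightarrow> 'a \<Rightarrow> 'a"
  where "J h y = (SOME f. f \<in> D \<and> f + h *\<^sub>R H f = y)"

context
  fixes h :: real
  assumes h: "h > 0"
begin

lemma J_D: "J h y \<in> D" and J_eq: "J h y + h *\<^sub>R H (J h y) = y"
proof -
  have "\<exists>f. f \<in> D \<and> f + h *\<^sub>R H f = y" using resolvent_equation(1)[OF h, of y] by blast
  from someI_ex[OF this] show "J h y \<in> D" "J h y + h *\<^sub>R H (J h y) = y" by (auto simp: J_def)
qed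

lemma J_unique:
  assumes "f \<in> D" "f + h *\<^sub>R H f = y"
  shows "J h y = f"
proof -
  have "norm (J h y - f) \<le> norm ((J h y - f) + h *\<^sub>R H (J h y - f))"
    by (intro resolvent_equation(2)[OF h] diff_D J_D assms)
  also have "(J h y - f) + h *\<^sub>R H (J h y - f) = (J h y + h *\<^sub>R H (J h y)) - (f + h *\<^sub>R H f)"
    by (simp add: H_diff J_D assms algebra_simps)
  also have "\<dots> = 0" by (simp only: J_eq assms) simp
  finally show ?thesis by simp
qed

lemma J_add: "J h (x + y) = J h x + J h y"
proof (rule J_unique)
  have "J h x + J h y + h *\<^sub>R H (J h x + J h y) = (J h x + h *\<^sub>R H (J h x)) + (J h y + h *\<^sub>R H (J h y))"
    by (simp add: H_add J_D algebra_simps)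
  then show "J h x + J h y + h *\<^sub>R H (J h x + J h y) = x + y" by (simp add: J_eq)
qed (simp add: add_D J_D)

lemma J_scaleC: "J h (c *\<^sub>C x) = c *\<^sub>C J h x"
proof (rule J_unique)
  have "c *\<^sub>C J h x + h *\<^sub>R H (c *\<^sub>C J h x) = c *\<^sub>C (J h x + h *\<^sub>R H (J h x))"
    by (simp add: H_scaleC J_D scaleC_add_right scaleC_scaleR)
  then show "c *\<^sub>C J h x + h *\<^sub>R H (c *\<^sub>C J h x) = c *\<^sub>C x" by (simp add: J_eq)
qed (simp add: scaleC_D J_D)

lemma J_diff: "J h (x - y) = J h x - J h y"
  using J_add[of x "(-1) *\<^sub>C y"] J_scaleC[of "-1" y] by simp

lemma norm_J_le: "norm (J h x) \<le> norm x"
  using resolvent_equation(2)[OF h J_D[of x]] by (simp add: J_eq)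

lemma J_nonexpansive: "norm (J h x - J h y) \<le> norm (x - y)"
  using norm_J_le[of "x - y"] by (simp add: J_diff)

text \<open>\<open>H (J h f)\<close> is a multiple of \<open>f - J h f\<close>, hence lies in
  \<open>D\<close> again when \<open>f\<close> does. So the resolvent gains one level of regularity,
  and applying \<open>H\<close> to its defining equation gives the identity.\<close>

lemma H_J: 
  assumes "f \<in> D"
  shows "H (J h f) = J h (H f)"
proof (rule J_unique[symmetric])
  have eq: "H (J h f) = (1 / h) *\<^sub>R (f - J h f)"
    using arg_cong[OF J_eq[of f], of "\<lambda>x. (1 / h) *\<^sub>R (x - J h f)"] h by simp
  show "H (J h f) \<in> D" unfolding eq by (intro scaleR_D diff_D J_D assms)
  have "H (H (J h f)) = H ((1 / h) *\<^sub>R (f - J h f))" by (simp only: eq[symmetric])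
  also have "\<dots> = (1 / h) *\<^sub>R (H f - H (J h f))"
    by (simp add: H_scaleR H_diff diff_D J_D assms)
  finally have "H (H (J h f)) = (1 / h) *\<^sub>R (H f - H (J h f))" .
  then show "H (J h f) + h *\<^sub>R H (H (J h f)) = H f" using h by simp
qed

lemma norm_J_diff_le: "f \<in> D \<Longrightarrow> norm (J h f - f) \<le> h * norm (H f)"
proof -
  assume "f \<in> D"
  have "J h f - f = - (h *\<^sub>R H (J h f))"
    using arg_cong[OF J_eq[of f], of "\<lambda>x. J h f - x"] by simp
  also have "norm \<dots> \<le> h * norm (H f)"
    using h norm_J_le[of "H f"] by (simp add: H_J[OF \<open>f \<in> D\<close>])
  finally show ?thesis .
qed

end

end

instance complex_hilbert \<subseteq> banach ..

lemma convergent_of_geometric_increments: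
  fixes f :: "nat \<Rightarrow> 'a::banach"
  assumes "\<And>n. norm (f (Suc n) - f n) \<le> C * (1 / 2) ^ n"
  shows "convergent f"
proof -
  have "summable (\<lambda>n. C * (1 / 2) ^ n :: real)" by (intro summable_mult summable_geometric) simp
  then have "summable (\<lambda>n. f (Suc n) - f n)"
    by (rule summable_comparison_test'[where N=0]) (rule assms)
  then have "convergent (\<lambda>n. f n - f 0)"
    by (simp add: summable_iff_convergent sum_lessThan_telescope)
  then show ?thesis by (simp add: convergent_diff_const_right_iff)
qed

section \<open>Strong convergence of the resolvents and density of the domain\<close>

context m_accretive_operator
begin

text \<open>Dyadic step sizes: refinement replaces each step by exactly two half steps, which makes
  consecutive approximations comparable.\<close>

definition mesh :: "nat \<Rightarrow> real"
  where "mesh n = (1 / 2) ^ n"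

lemma mesh_pos [simp]: "mesh n > 0"
  by (simp add: mesh_def)

lemma mesh_Suc: "mesh (Suc n) = mesh n / 2"
  by (simp add: mesh_def)

lemma mesh_tendsto: "mesh \<longlonglongrightarrow> 0"
  unfolding mesh_def by (rule LIMSEQ_power_zero) simp

lemma H_J_eq: "h > 0 \<Longrightarrow> H (J h x) = (1 / h) *\<^sub>R (x - J h x)"
  using arg_cong[OF J_eq[of h x], of "\<lambda>y. (1 / h) *\<^sub>R (y - J h x)"] by simp

text \<open>The displacement x - J h x is h times \<open>H (J h x)\<close>. Accretivity for the
  difference of the two resolvent values is therefore an inequality between two displacements, and
  it rearranges to this one. Decreasing norms of displacements thus control their mutual
  distances.\<close>

lemma J_complement_diff:
  assumes "0 < g" "g < h"
  shows "(norm ((x - J h x) - (x - J g x)))\<^sup>2 \<le> (norm (x - J h x))\<^sup>2 - (norm (x - J g x))\<^sup>2"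
proof -
  have "h > 0" using assms by simp
  define a b u v where "a = 1 / h" and "b = 1 / g" and "u = x - J h x" and "v = x - J g x"
  have ab: "0 < a" "a < b" using assms by (auto simp: a_def b_def field_simps)
  have "H (J h x - J g x) \<bullet> (J h x - J g x) \<ge> 0"
    by (intro accretive diff_D J_D assms \<open>h > 0\<close>)
  moreover have "H (J h x - J g x) = a *\<^sub>R u - b *\<^sub>R v"
    using assms \<open>h > 0\<close> by (simp add: H_diff J_D H_J_eq a_def b_def u_def v_def)
  moreover have "J h x - J g x = v - u" by (simp add: u_def v_def)
  ultimately have "(a *\<^sub>R u - b *\<^sub>R v) \<bullet> (v - u) \<ge> 0" by simp
  then have ineq: "a * (u \<bullet> u) + b * (v \<bullet> v) \<le> (a + b) * (u \<bullet> v)"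
    by (simp add: inner_diff_left inner_diff_right inner_commute[of v u] distrib_right)
  have "(a + b) * ((norm (u - v))\<^sup>2) = (a + b) * (u \<bullet> u + v \<bullet> v) - 2 * ((a + b) * (u \<bullet> v))"
    by (simp add: power2_norm_eq_inner inner_diff_left inner_diff_right inner_commute[of v u] algebra_simps)
  also have "\<dots> \<le> (b - a) * (u \<bullet> u - v \<bullet> v)" using ineq by (simp add: algebra_simps)
  finally have *: "(a + b) * (norm (u - v))\<^sup>2 \<le> (b - a) * (u \<bullet> u - v \<bullet> v)" .
  moreover have "0 \<le> (a + b) * (norm (u - v))\<^sup>2" using ab by (intro mult_nonneg_nonneg) auto
  ultimately have "0 \<le> (b - a) * (u \<bullet> u - v \<bullet> v)" by linarith
  then have pos: "0 \<le> u \<bullet> u - v \<bullet> v" using ab mult_pos_neg[of "b - a" "u \<bullet> u - v \<bullet> v"] by linarith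
  have "(b - a) * (u \<bullet> u - v \<bullet> v) \<le> (a + b) * (u \<bullet> u - v \<bullet> v)"
    using ab by (intro mult_right_mono pos) auto
  with * have "(a + b) * (norm (u - v))\<^sup>2 \<le> (a + b) * (u \<bullet> u - v \<bullet> v)" by linarith
  then have "(norm (u - v))\<^sup>2 \<le> u \<bullet> u - v \<bullet> v" using ab by simp
  then show ?thesis by (simp add: power2_norm_eq_inner u_def v_def)
qed

text \<open>The squared norms of the displacements decrease and so converge, which makes the
  displacements themselves a Cauchy sequence. The closed graph then identifies their limit as 0; no
  prior density of \<open>D\<close> enters.\<close>

lemma J_mesh_tendsto: "(\<lambda>n. J (mesh n) x) \<longlonglongrightarrow> x"
proof -
  define u where "u n = x - J (mesh n) x" for n
  define q where "q n = (norm (u n))\<^sup>2" for n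
  have mesh_less: "mesh n < mesh m" if "m < n" for m n
    using that by (simp add: mesh_def)
  have q: "(norm (u m - u n))\<^sup>2 \<le> q m - q n" if "m < n" for m n
    using J_complement_diff[of "mesh n" "mesh m" x] mesh_less[OF that] by (simp add: u_def q_def)
  have "q (Suc n) \<le> q n" for n
    using q[of n "Suc n"] zero_le_power2[of "norm (u n - u (Suc n))"] by linarith
  then have "decseq q" by (rule decseq_SucI)
  moreover have "Bseq q"
  proof (rule BseqI')
    show "norm (q n) \<le> q 0" for n using decseqD[OF \<open>decseq q\<close>, of 0 n] by (simp add: q_def)
  qed
  ultimately have "Cauchy q"
    by (simp add: Bseq_monoseq_convergent decseq_imp_monoseq convergent_Cauchy)
  have "Cauchy u"
  proof (rule CauchyI')
    fix e :: real assume "e > 0"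
    then have "0 < e\<^sup>2" by simp
    then obtain M where M: "\<And>m n. M \<le> m \<Longrightarrow> M \<le> n \<Longrightarrow> norm (q m - q n) < e\<^sup>2"
      using CauchyD[OF \<open>Cauchy q\<close>] by metis
    have "dist (u m) (u n) < e" if "M \<le> m" "m < n" for m n
    proof -
      have "(norm (u m - u n))\<^sup>2 < e\<^sup>2" using q[OF that(2)] M[of m n] that by fastforce
      then show ?thesis using \<open>e > 0\<close> by (simp add: dist_norm power_less_imp_less_base)
    qed
    then show "\<exists>M. \<forall>m\<ge>M. \<forall>n>m. dist (u m) (u n) < e" by blast
  qed
  then obtain w where w: "u \<longlonglongrightarrow> w" using Cauchy_convergent convergent_def by blast
  \<comment> \<open>These vectors tend to 0 while \<open>H\<close> maps them to \<open>u n\<close>,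
    so closedness forces the limit of \<open>u\<close> to be \<open>H 0 = 0\<close>.\<close>
  have "(\<lambda>n. mesh n *\<^sub>R J (mesh n) x) \<longlonglongrightarrow> 0"
  proof (rule Lim_null_comparison)
    show "\<forall>\<^sub>F n in sequentially. norm (mesh n *\<^sub>R J (mesh n) x) \<le> mesh n * norm x"
      by (intro always_eventually allI) (simp add: norm_J_le less_imp_le)
    show "(\<lambda>n. mesh n * norm x) \<longlonglongrightarrow> 0" using tendsto_mult_left_zero[OF mesh_tendsto] by simp
  qed
  moreover have "H (mesh n *\<^sub>R J (mesh n) x) = u n" for n
    using less_imp_neq[OF mesh_pos[of n]] by (simp add: H_scaleR J_D H_J_eq u_def)
  then have "(\<lambda>n. H (mesh n *\<^sub>R J (mesh n) x)) \<longlonglongrightarrow> w" using w by simp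
  ultimately have "H 0 = w" using graph_closedI[of "\<lambda>n. mesh n *\<^sub>R J (mesh n) x" 0 w] scaleR_D J_D mesh_pos by blast
  then have "u \<longlonglongrightarrow> 0" using w by simp
  then have "(\<lambda>n. x - u n) \<longlonglongrightarrow> x - 0" by (intro tendsto_intros)
  then show ?thesis by (simp add: u_def)
qed

text \<open>The domain of \<open>H\<close> squared, on which halving a step makes a local error of
  second order.\<close>

definition D2 :: "'a set"
  where "D2 = {x \<in> D. H x \<in> D}"

text \<open>One resolvent moves \<open>x\<close> into \<open>D\<close> and a second one moves the
  result into \<open>D2\<close>, since \<open>H\<close> commutes with the resolvent on
  \<open>D\<close>.\<close>

lemma closure_D2: "closure D2 = UNIV"
proof -
  have "x \<in> closure D2" for x
    unfolding closure_sequential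
  proof (intro exI conjI allI)
    show "J (mesh n) (J (mesh n) x) \<in> D2" for n by (simp add: D2_def J_D H_J)
    have le: "\<forall>n. norm (J (mesh n) (J (mesh n) x) - J (mesh n) x) \<le> norm (J (mesh n) x - x)"
      by (simp add: J_nonexpansive)
    have "(\<lambda>n. norm (J (mesh n) x - x)) \<longlonglongrightarrow> 0"
      by (intro tendsto_norm_zero LIM_zero J_mesh_tendsto)
    with always_eventually[OF le]
    have "(\<lambda>n. J (mesh n) (J (mesh n) x) - J (mesh n) x) \<longlonglongrightarrow> 0"
      by (rule Lim_null_comparison)
    from tendsto_add[OF this J_mesh_tendsto[of x]]
    show "(\<lambda>n. J (mesh n) (J (mesh n) x)) \<longlonglongrightarrow> x" by simp
  qed
  then show ?thesis by auto
qed

lemma D2_approx: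
  assumes "e > 0"
  obtains y where "y \<in> D2" "y \<in> D" "norm (x - y) < e"
proof -
  have "x \<in> closure D2" by (simp add: closure_D2)
  then obtain y where "y \<in> D2" "dist y x < e" using closure_approachable assms by blast
  then show thesis using that[of y] by (auto simp: D2_def dist_norm norm_minus_commute)
qed

lemma dense_extend:
  assumes "closed {x. P x}" and "\<And>x. x \<in> D \<Longrightarrow> P x"
  shows "P x"
proof -
  have "closure D2 \<subseteq> {x. P x}" using assms by (intro closure_minimal) (auto simp: D2_def)
  then show ?thesis by (auto simp: closure_D2)
qed

text \<open>With g = h / 2, (1 + gH)^2 = 1 + hH + g^2 H^2. So two half steps solve the equation of
  one full step with data perturbed by g^2 H^2 z, and \<open>J h\<close> does not enlarge this
  perturbation.\<close>

lemma J_twice_half: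
  assumes "h > 0" "x \<in> D2"
  shows "norm (J (h / 2) (J (h / 2) x) - J h x) \<le> h\<^sup>2 / 4 * norm (H (H x))"
proof -
  define g where "g = h / 2"
  have g: "g > 0" "h = 2 * g" using assms by (auto simp: g_def)
  define y where "y = J g x"
  define z where "z = J g y"
  have x: "x \<in> D" "H x \<in> D" using assms by (auto simp: D2_def)
  have D: "y \<in> D" "z \<in> D" by (auto simp: y_def z_def J_D g)
  have Hz: "H z = J g (J g (H x))" by (simp add: y_def z_def H_J g x J_D)
  have "H z \<in> D" by (simp add: Hz J_D g)
  have HHz: "H (H z) = J g (J g (H (H x)))" by (simp add: Hz H_J J_D g x)
  have eq: "z + h *\<^sub>R H z + g\<^sup>2 *\<^sub>R H (H z) = x"
  proof -
    have x: "x = y + g *\<^sub>R H y" using J_eq[OF g(1), of x] by (simp add: y_def)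
    have y: "y = z + g *\<^sub>R H z" using J_eq[OF g(1), of y] by (simp add: z_def)
    have "H y = H z + g *\<^sub>R H (H z)"
      by (subst y) (simp add: H_add H_scaleR scaleR_D D \<open>H z \<in> D\<close>)
    then have "x = z + g *\<^sub>R H z + g *\<^sub>R (H z + g *\<^sub>R H (H z))"
      using x y by simp
    then show ?thesis by (simp add: g scaleR_add_right scaleR_2 power2_eq_square flip: scaleR_scaleR)
  qed
  have "z = J h (x - g\<^sup>2 *\<^sub>R H (H z))"
    using assms(1) D eq by (intro J_unique[symmetric]) (auto simp: algebra_simps)
  then have "norm (z - J h x) = norm (J h (x - g\<^sup>2 *\<^sub>R H (H z)) - J h x)" by simp
  also have "\<dots> \<le> norm (g\<^sup>2 *\<^sub>R H (H z))" using J_nonexpansive[OF assms(1), of "x - g\<^sup>2 *\<^sub>R H (H z)" x] by simp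
  also have "\<dots> = g\<^sup>2 * norm (J g (J g (H (H x))))" by (simp add: HHz)
  also have "\<dots> \<le> g\<^sup>2 * norm (H (H x))"
    by (intro mult_left_mono order_trans[OF norm_J_le[OF g(1)] norm_J_le[OF g(1)]]) auto
  finally show ?thesis by (simp add: z_def y_def g_def power2_eq_square)
qed

lemma
  assumes "h > 0"
  shows norm_J_power_le: "norm ((J h ^^ k) x) \<le> norm x"
    and J_power_add: "(J h ^^ k) (x + y) = (J h ^^ k) x + (J h ^^ k) y"
    and J_power_diff: "(J h ^^ k) (x - y) = (J h ^^ k) x - (J h ^^ k) y"
    and J_power_scaleC: "(J h ^^ k) (c *\<^sub>C x) = c *\<^sub>C (J h ^^ k) x"
    and J_power_D: "x \<in> D \<Longrightarrow> (J h ^^ k) x \<in> D"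
    and H_J_power: "x \<in> D \<Longrightarrow> H ((J h ^^ k) x) = (J h ^^ k) (H x)"
proof -
  show "norm ((J h ^^ k) x) \<le> norm x" by (intro funpow_contraction norm_J_le assms)
  show "(J h ^^ k) (x + y) = (J h ^^ k) x + (J h ^^ k) y" by (induction k) (auto simp: J_add assms)
  show "(J h ^^ k) (x - y) = (J h ^^ k) x - (J h ^^ k) y" by (induction k) (auto simp: J_diff assms)
  show "(J h ^^ k) (c *\<^sub>C x) = c *\<^sub>C (J h ^^ k) x" by (induction k) (auto simp: J_scaleC assms)
  show D: "(J h ^^ k) x \<in> D" if "x \<in> D" for k by (intro funpow_closed that J_D assms)
  show "H ((J h ^^ k) x) = (J h ^^ k) (H x)" if "x \<in> D"
    by (induction k) (auto simp: H_J assms D that)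
qed

lemma J_power_nonexpansive: "h > 0 \<Longrightarrow> norm ((J h ^^ k) x - (J h ^^ k) y) \<le> norm (x - y)"
  by (metis J_power_diff norm_J_power_le)

lemma J_power_scaleR: "h > 0 \<Longrightarrow> (J h ^^ k) (r *\<^sub>R x) = r *\<^sub>R (J h ^^ k) x"
  using J_power_scaleC[of h k "of_real r" x] by (simp add: scaleC_of_real)

lemma norm_J_power_diff_le:
  assumes "h > 0" "x \<in> D"
  shows "norm ((J h ^^ k) x - x) \<le> real k * h * norm (H x)"
proof -
  have "norm ((J h ^^ k) x - (id ^^ k) x) \<le> real k * (h * norm (H x))"
    by (rule funpow_diff_le[where A="{x}"])
      (auto simp: J_nonexpansive assms norm_J_diff_le)
  then show ?thesis by (simp add: mult.assoc)
qed

end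

subsection \<open>The semigroup as a limit of implicit Euler steps\<close>

context m_accretive_operator
begin

definition steps :: "nat \<Rightarrow> real \<Rightarrow> nat"
  where "steps n t = nat \<lfloor>t * 2 ^ n\<rfloor>"

definition euler :: "nat \<Rightarrow> real \<Rightarrow> 'a \<Rightarrow> 'a"
  where "euler n t = J (mesh n) ^^ steps n t"

definition S :: "real \<Rightarrow> 'a \<Rightarrow> 'a"
  where "S t x = lim (\<lambda>n. euler n t x)"

lemma steps_bounds:
  assumes "t \<ge> 0"
  shows "real (steps n t) * mesh n \<le> t" "t - mesh n \<le> real (steps n t) * mesh n"
proof -
  have m: "mesh n * 2 ^ n = 1" by (simp add: mesh_def power_one_over)
  have "real (steps n t) \<le> t * 2 ^ n" "t * 2 ^ n - 1 \<le> real (steps n t)"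
    using assms by (auto simp: steps_def)
  from this[THEN mult_right_mono, of "mesh n"]
  show "real (steps n t) * mesh n \<le> t" "t - mesh n \<le> real (steps n t) * mesh n"
    using m less_imp_le[OF mesh_pos[of n]] by (auto simp: algebra_simps)
qed

lemma steps_Suc:
  assumes "t \<ge> 0"
  shows "steps (Suc n) t = steps n t * 2 \<or> steps (Suc n) t = Suc (steps n t * 2)"
proof -
  have "0 \<le> t * 2 ^ n" using assms by simp
  moreover have "t * 2 ^ Suc n = 2 * (t * 2 ^ n)" by simp
  ultimately show ?thesis unfolding steps_def by linarith
qed

lemma steps_add:
  assumes "s \<ge> 0" "t \<ge> 0"
  shows "steps n (s + t) = steps n s + steps n t \<or> steps n (s + t) = Suc (steps n s + steps n t)"
proof -
  have "0 \<le> s * 2 ^ n" "0 \<le> t * 2 ^ n" using assms by auto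
  moreover have "(s + t) * 2 ^ n = s * 2 ^ n + t * 2 ^ n" by (simp add: distrib_right)
  ultimately show ?thesis unfolding steps_def by linarith
qed

lemma steps_mesh_tendsto:
  assumes "t \<ge> 0"
  shows "(\<lambda>n. real (steps n t) * mesh n) \<longlonglongrightarrow> t"
proof (rule tendsto_sandwich)
  show "(\<lambda>n. t - mesh n) \<longlonglongrightarrow> t" using tendsto_diff[OF tendsto_const mesh_tendsto, of t] by simp
qed (use steps_bounds[OF assms] in auto)

text \<open>From level n to n + 1, each of at most t / h full steps is split in two at a cost of
  order h^2, in total of order t h. Rounding may leave one extra half step, which costs at most
  \<open>h * norm (H x)\<close>.\<close>

lemma euler_increment:
  assumes "t \<ge> 0" "x \<in> D2"
  shows "norm (euler (Suc n) t x - euler n t x) \<le> (t * norm (H (H x)) + norm (H x)) * (1 / 2) ^ n"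
proof -
  define h k where "h = mesh n" and "k = steps n t"
  have h: "h > 0" "h / 2 > 0" by (auto simp: h_def)
  have x: "x \<in> D" "H x \<in> D" using assms by (auto simp: D2_def)
  have double: "(J (h / 2) ^^ (k * 2)) = ((\<lambda>y. J (h / 2) (J (h / 2) y)) ^^ k)"
  proof -
    have "(J (h / 2) ^^ 2) = (\<lambda>y. J (h / 2) (J (h / 2) y))" by (simp add: numeral_2_eq_2 fun_eq_iff)
    then show ?thesis using funpow_mult[where f="J (h / 2)" and m=2 and n=k] by (simp add: mult.commute)
  qed
  have "norm ((J (h / 2) ^^ (k * 2)) x - (J h ^^ k) x) \<le> real k * (h\<^sup>2 / 4 * norm (H (H x)))"
    unfolding double
  \<comment> \<open>The invariant set: the resolvent commutes with \<open>H\<close> and is a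
    contraction, so the norm of \<open>H (H y)\<close> never grows along the orbit.\<close>
  proof (rule funpow_diff_le[where A="{y \<in> D2. norm (H (H y)) \<le> norm (H (H x))}"])
    show "norm (J (h / 2) (J (h / 2) y) - J (h / 2) (J (h / 2) z)) \<le> norm (y - z)" for y z
      by (intro order_trans[OF J_nonexpansive J_nonexpansive] h)
    show "J h y \<in> {y \<in> D2. norm (H (H y)) \<le> norm (H (H x))}"
      if "y \<in> {y \<in> D2. norm (H (H y)) \<le> norm (H (H x))}" for y
      using that h(1) by (auto simp: D2_def J_D H_J intro: order_trans[OF norm_J_le[OF h(1)]])
    show "norm (J (h / 2) (J (h / 2) y) - J h y) \<le> h\<^sup>2 / 4 * norm (H (H x))"
      if "y \<in> {y \<in> D2. norm (H (H y)) \<le> norm (H (H x))}" for y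
    proof -
      have "norm (J (h / 2) (J (h / 2) y) - J h y) \<le> h\<^sup>2 / 4 * norm (H (H y))"
        using that by (intro J_twice_half h) simp
      also have "\<dots> \<le> h\<^sup>2 / 4 * norm (H (H x))" using that by (intro mult_left_mono) auto
      finally show ?thesis .
    qed
  qed (use assms in auto)
  also have "\<dots> = (real k * h) * h * norm (H (H x)) / 4" by (simp add: power2_eq_square)
  also have "\<dots> \<le> t * h * norm (H (H x)) / 4"
    using steps_bounds(1)[OF assms(1), of n] h(1)
    by (intro divide_right_mono mult_right_mono) (auto simp: h_def k_def less_imp_le)
  also have "\<dots> \<le> h * (t * norm (H (H x)))"
    using assms h by (simp add: field_simps)
  finally have 1: "norm ((J (h / 2) ^^ (k * 2)) x - (J h ^^ k) x) \<le> h * (t * norm (H (H x)))" .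
  have 2: "norm ((J (h / 2) ^^ Suc (k * 2)) x - (J (h / 2) ^^ (k * 2)) x) \<le> h * norm (H x)"
  proof -
    have "norm ((J (h / 2) ^^ Suc (k * 2)) x - (J (h / 2) ^^ (k * 2)) x) \<le> norm (J (h / 2) x - x)"
      unfolding funpow_Suc_right comp_def by (intro J_power_nonexpansive h)
    also have "\<dots> \<le> h / 2 * norm (H x)" by (intro norm_J_diff_le h x)
    also have "\<dots> \<le> h * norm (H x)" using h by (intro mult_right_mono) auto
    finally show ?thesis .
  qed
  have pos: "0 \<le> h * (t * norm (H (H x)))" "0 \<le> h * norm (H x)" using h assms by auto
  have "norm (euler (Suc n) t x - euler n t x) \<le> h * (t * norm (H (H x))) + h * norm (H x)"
  proof (cases "steps (Suc n) t = k * 2")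
    case True
    then show ?thesis using 1 pos by (simp add: euler_def k_def h_def mesh_Suc)
  next
    case False
    then have "steps (Suc n) t = Suc (k * 2)" using steps_Suc[OF assms(1), of n] by (simp add: k_def)
    then have "euler (Suc n) t x - euler n t x = ((J (h / 2) ^^ Suc (k * 2)) x - (J (h / 2) ^^ (k * 2)) x)
        + ((J (h / 2) ^^ (k * 2)) x - (J h ^^ k) x)"
      by (simp add: euler_def k_def h_def mesh_Suc del: funpow.simps)
    then show ?thesis using norm_triangle_le[OF add_mono[OF 2 1]] by (simp only: add.commute)
  qed
  then show ?thesis by (simp add: h_def mesh_def algebra_simps)
qed

lemma norm_euler_le: "norm (euler n t x) \<le> norm x"
  and euler_diff: "euler n t (x - y) = euler n t x - euler n t y"
  and euler_add: "euler n t (x + y) = euler n t x + euler n t y"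
  and euler_scaleC: "euler n t (c *\<^sub>C x) = c *\<^sub>C euler n t x"
  and euler_D: "x \<in> D \<Longrightarrow> euler n t x \<in> D"
  and H_euler: "x \<in> D \<Longrightarrow> H (euler n t x) = euler n t (H x)"
  unfolding euler_def
  by (auto intro: norm_J_power_le J_power_diff J_power_add J_power_scaleC J_power_D H_J_power)

lemma euler_nonexpansive: "norm (euler n t x - euler n t y) \<le> norm (x - y)"
  by (metis euler_diff norm_euler_le)

text \<open>Geometric increments give convergence on the dense set \<open>D2\<close>;
  nonexpansiveness, uniform in n, carries the Cauchy property over to every vector.\<close>

lemma euler_tendsto:
  assumes "t \<ge> 0"
  shows "(\<lambda>n. euler n t x) \<longlonglongrightarrow> S t x"
proof -
  have "Cauchy (\<lambda>n. euler n t x)"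
  proof (rule CauchyI)
    fix e :: real assume "e > 0"
    then obtain y where y: "y \<in> D2" "norm (x - y) < e / 3" using D2_approx[of "e / 3" x] by auto
    have "convergent (\<lambda>n. euler n t y)"
      by (rule convergent_of_geometric_increments[OF euler_increment[OF assms y(1)]])
    then have "Cauchy (\<lambda>n. euler n t y)" by (rule convergent_Cauchy)
    then obtain M where M: "\<And>m n. m \<ge> M \<Longrightarrow> n \<ge> M \<Longrightarrow> norm (euler m t y - euler n t y) < e / 3"
      using CauchyD[of _ "e / 3"] \<open>e > 0\<close> by (metis divide_pos_pos zero_less_numeral)
    have "norm (euler m t x - euler n t x) < e" if "m \<ge> M" "n \<ge> M" for m n
    proof -
      have eq: "euler m t x - euler n t x = (euler m t x - euler m t y) + (euler m t y - euler n t y) + (euler n t y - euler n t x)"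
        by simp
      have "norm (euler m t x - euler n t x)
          \<le> norm (euler m t x - euler m t y) + norm (euler m t y - euler n t y) + norm (euler n t y - euler n t x)"
        unfolding eq by (intro norm_triangle_le add_mono norm_triangle_ineq order_refl)
      also have "\<dots> < e"
        using euler_nonexpansive[of m t x y] M[OF that] euler_nonexpansive[of n t y x] y(2)
        by (simp add: norm_minus_commute)
      finally show ?thesis .
    qed
    then show "\<exists>M. \<forall>m\<ge>M. \<forall>n\<ge>M. norm (euler m t x - euler n t x) < e" by blast
  qed
  then show ?thesis
    unfolding S_def by (intro convergent_LIMSEQ_iff[THEN iffD1] Cauchy_convergent)
qed

lemma norm_S_le: "t \<ge> 0 \<Longrightarrow> norm (S t x) \<le> norm x"
  by (rule LIMSEQ_le_const2[OF tendsto_norm[OF euler_tendsto]]) (auto intro: norm_euler_le)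

lemma S_add: "t \<ge> 0 \<Longrightarrow> S t (x + y) = S t x + S t y"
  by (rule LIMSEQ_unique[OF euler_tendsto]) (auto simp: euler_add intro!: tendsto_add euler_tendsto)

lemma S_scaleC: "t \<ge> 0 \<Longrightarrow> S t (c *\<^sub>C x) = c *\<^sub>C S t x"
  by (rule LIMSEQ_unique[OF euler_tendsto]) (auto simp: euler_scaleC intro!: tendsto_scaleC euler_tendsto)

lemma bounded_clinear_S: "t \<ge> 0 \<Longrightarrow> bounded_clinear (S t)"
  unfolding bounded_clinear_def
proof (intro conjI allI)
  assume t: "t \<ge> 0"
  show "bounded_linear (S t)"
  proof (rule bounded_linear_intro[where K=1])
    show "S t (r *\<^sub>R x) = r *\<^sub>R S t x" for r x
      using S_scaleC[OF t, of "of_real r" x] by (simp add: scaleC_of_real)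
  qed (auto simp: S_add norm_S_le t)
qed (simp add: S_scaleC)

lemma S_D:
  assumes "t \<ge> 0" "x \<in> D"
  shows "S t x \<in> D" "H (S t x) = S t (H x)"
proof -
  have "(\<lambda>n. H (euler n t x)) \<longlonglongrightarrow> S t (H x)" using assms by (simp add: H_euler euler_tendsto)
  then have "S t x \<in> D \<and> H (S t x) = S t (H x)"
    by (rule graph_closedI[OF euler_D[OF assms(2)] euler_tendsto[OF assms(1)]])
  then show "S t x \<in> D" "H (S t x) = S t (H x)" by auto
qed

lemma S_zero: "S 0 x = x"
  unfolding S_def by (simp add: euler_def steps_def)

text \<open>Rounding down is additive up to one missing step, and that step moves the result by at
  most \<open>norm (J (mesh n) x - x)\<close>, which tends to 0.\<close>

lemma S_semigroup:
  assumes "s \<ge> 0" "t \<ge> 0"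
  shows "S (s + t) x = S s (S t x)"
proof -
  have "norm (euler n (s + t) x - euler n s (euler n t x)) \<le> norm (J (mesh n) x - x)" for n
  proof -
    have EE: "euler n s (euler n t x) = (J (mesh n) ^^ (steps n s + steps n t)) x"
      by (simp add: euler_def funpow_add)
    show ?thesis
    proof (cases "steps n (s + t) = steps n s + steps n t")
      case False
      then have "euler n (s + t) x = (J (mesh n) ^^ (steps n s + steps n t)) (J (mesh n) x)"
        using steps_add[OF assms, of n] by (simp add: euler_def funpow_swap1)
      then show ?thesis unfolding EE by (simp add: J_power_nonexpansive)
    qed (unfold EE, simp add: euler_def)
  qed
  then have "\<forall>\<^sub>F n in sequentially. norm (euler n (s + t) x - euler n s (euler n t x)) \<le> norm (J (mesh n) x - x)"
    by simp
  then have 1: "(\<lambda>n. euler n (s + t) x - euler n s (euler n t x)) \<longlonglongrightarrow> 0"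
    by (rule Lim_null_comparison) (intro tendsto_norm_zero LIM_zero J_mesh_tendsto)
  have "\<forall>\<^sub>F n in sequentially. norm (euler n s (euler n t x) - euler n s (S t x)) \<le> norm (euler n t x - S t x)"
    by (simp add: euler_nonexpansive)
  then have 2: "(\<lambda>n. euler n s (euler n t x) - euler n s (S t x)) \<longlonglongrightarrow> 0"
    by (rule Lim_null_comparison) (intro tendsto_norm_zero LIM_zero euler_tendsto assms)
  have "(\<lambda>n. euler n (s + t) x) \<longlonglongrightarrow> S s (S t x)"
    using tendsto_add[OF tendsto_add[OF 1 2] euler_tendsto[OF assms(1), of "S t x"]] by simp
  then show ?thesis using euler_tendsto[of "s + t" x] LIMSEQ_unique assms by (metis add_nonneg_nonneg)
qed

text \<open>The increment of the k-th step is exactly -h times \<open>(J h ^^ Suc k) (H x)\<close>.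
  Replacing this by -h times \<open>H x\<close> has a first-order cost for vectors in
  \<open>D\<close>, so \<open>H x\<close> is exchanged for a nearby \<open>z\<close> in
  \<open>D\<close>, before and after the contraction. This gives differentiability on all of
  \<open>D\<close> and not only on \<open>D2\<close>.\<close>

lemma J_power_increment:
  assumes "h > 0" "x \<in> D" "z \<in> D"
  shows "norm ((J h ^^ k) x - x + (real k * h) *\<^sub>R H x)
    \<le> real k * h * (2 * norm (H x - z) + real k * h * norm (H z))"
proof (induction k)
  case (Suc k)
  define y where "y = H x"
  have "J h x - x = - (h *\<^sub>R J h y)"
    using arg_cong[OF J_eq[OF assms(1), of x], of "\<lambda>w. J h x - w"] by (simp add: y_def H_J assms)
  then have "(J h ^^ Suc k) x - (J h ^^ k) x = (J h ^^ k) ((-h) *\<^sub>R J h y)"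
    by (simp add: funpow_swap1 flip: J_power_diff[OF assms(1)])
  also have "\<dots> = - (h *\<^sub>R (J h ^^ Suc k) y)"
    by (subst J_power_scaleR[OF assms(1)]) (simp add: funpow_swap1)
  finally have step: "(J h ^^ Suc k) x = (J h ^^ k) x - h *\<^sub>R (J h ^^ Suc k) y"
    by (simp add: algebra_simps)
  have "norm (y - (J h ^^ Suc k) y) \<le> 2 * norm (y - z) + real (Suc k) * h * norm (H z)"
  proof -
    have "y - (J h ^^ Suc k) y = (y - z) + - ((J h ^^ Suc k) z - z) + (J h ^^ Suc k) (z - y)"
      by (simp only: J_power_diff[OF assms(1)]) simp
    also have "norm \<dots> \<le> norm (y - z) + norm ((J h ^^ Suc k) z - z) + norm ((J h ^^ Suc k) (z - y))"
      by (intro norm_triangle_le add_mono order_refl) (simp only: norm_minus_cancel order_refl)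
    also have "\<dots> \<le> norm (y - z) + real (Suc k) * h * norm (H z) + norm (z - y)"
      by (intro add_mono order_refl norm_J_power_diff_le norm_J_power_le assms)
    finally show ?thesis by (simp add: norm_minus_commute)
  qed
  then have 1: "norm (h *\<^sub>R (y - (J h ^^ Suc k) y)) \<le> h * (2 * norm (y - z) + real (Suc k) * h * norm (H z))"
    using assms(1) by simp
  have "(J h ^^ Suc k) x - x + (real (Suc k) * h) *\<^sub>R y
      = ((J h ^^ k) x - x + (real k * h) *\<^sub>R y) + h *\<^sub>R (y - (J h ^^ Suc k) y)"
    unfolding step by (simp add: algebra_simps del: funpow.simps)
  also have "norm \<dots> \<le> real k * h * (2 * norm (y - z) + real k * h * norm (H z))
      + h * (2 * norm (y - z) + real (Suc k) * h * norm (H z))"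
    by (rule norm_triangle_le[OF add_mono[OF Suc[folded y_def] 1]])
  also have "\<dots> \<le> real k * h * (2 * norm (y - z) + real (Suc k) * h * norm (H z))
      + h * (2 * norm (y - z) + real (Suc k) * h * norm (H z))"
    using assms(1) by (intro add_mono mult_left_mono mult_right_mono) auto
  also have "\<dots> = real (Suc k) * h * (2 * norm (y - z) + real (Suc k) * h * norm (H z))"
    by (simp add: algebra_simps)
  finally show ?case by (simp add: y_def)
qed simp

lemma S_increment:
  assumes "t \<ge> 0" "x \<in> D" "z \<in> D"
  shows "norm (S t x - x + t *\<^sub>R H x) \<le> t * (2 * norm (H x - z) + t * norm (H z))"
proof (rule LIMSEQ_le)
  show "(\<lambda>n. norm (euler n t x - x + (real (steps n t) * mesh n) *\<^sub>R H x)) \<longlonglongrightarrow> norm (S t x - x + t *\<^sub>R H x)"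
    by (intro tendsto_intros euler_tendsto steps_mesh_tendsto assms)
  show "(\<lambda>n. (real (steps n t) * mesh n) * (2 * norm (H x - z) + (real (steps n t) * mesh n) * norm (H z)))
      \<longlonglongrightarrow> t * (2 * norm (H x - z) + t * norm (H z))"
    by (intro tendsto_intros steps_mesh_tendsto assms)
qed (use J_power_increment[OF mesh_pos assms(2,3)] in \<open>auto simp: euler_def\<close>)

lemma S_increment_uniform:
  assumes "x \<in> D" "e > 0"
  obtains d where "d > 0" "\<And>t. 0 \<le> t \<Longrightarrow> t < d \<Longrightarrow> norm (S t x - x + t *\<^sub>R H x) \<le> e * t"
proof -
  \<comment> \<open>This choice uses up \<open>e / 2\<close> of the slope; the remaining error is
    quadratic in \<open>t\<close> and is absorbed by small \<open>t\<close>.\<close>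
  obtain z where z: "z \<in> D" "norm (H x - z) < e / 4" using D2_approx[of "e / 4" "H x"] assms(2) by auto
  define d where "d = e / (2 * (norm (H z) + 1))"
  have pos: "norm (H z) + 1 > 0" by (simp add: add_nonneg_pos)
  then have "d > 0" using assms(2) by (simp add: d_def)
  moreover have "norm (S t x - x + t *\<^sub>R H x) \<le> e * t" if t: "0 \<le> t" "t < d" for t
  proof -
    have "t * norm (H z) \<le> d * (norm (H z) + 1)" using t by (intro mult_mono) auto
    also have "\<dots> = e / 2" using pos by (simp add: d_def field_simps)
    finally have "t * (2 * norm (H x - z) + t * norm (H z)) \<le> t * e"
      using z t(1) by (intro mult_left_mono) auto
    then show ?thesis using S_increment[OF t(1) assms(1) z(1)] by (simp add: mult.commute)
  qed
  ultimately show thesis by (rule that)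
qed

lemma norm_S_diff_le:
  assumes "t \<ge> 0" "x \<in> D"
  shows "norm (S t x - x) \<le> t * norm (H x)"
proof (rule LIMSEQ_le)
  show "(\<lambda>n. norm (euler n t x - x)) \<longlonglongrightarrow> norm (S t x - x)"
    by (intro tendsto_intros euler_tendsto assms)
  show "(\<lambda>n. real (steps n t) * mesh n * norm (H x)) \<longlonglongrightarrow> t * norm (H x)"
    by (intro tendsto_intros steps_mesh_tendsto assms)
qed (use norm_J_power_diff_le[OF mesh_pos assms(2)] in \<open>auto simp: euler_def\<close>)

lemma S_diff: "t \<ge> 0 \<Longrightarrow> S t (x - y) = S t x - S t y"
  using bounded_clinear_S[of t] by (simp add: bounded_clinear_def bounded_linear.linear linear_diff)

lemma S_scaleR: "t \<ge> 0 \<Longrightarrow> S t (r *\<^sub>R x) = r *\<^sub>R S t x"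
  using bounded_clinear_S[of t] by (simp add: bounded_clinear_def bounded_linear.linear linear_scale)

lemma S_nonexpansive: "t \<ge> 0 \<Longrightarrow> norm (S t x - S t y) \<le> norm (x - y)"
  by (metis S_diff norm_S_le)

lemma S_near_zero:
  assumes "e > 0"
  obtains d where "d > 0" "\<And>t. 0 \<le> t \<Longrightarrow> t < d \<Longrightarrow> norm (S t x - x) < e"
proof -
  obtain y where y: "y \<in> D" "norm (x - y) < e / 3" using D2_approx[of "e / 3" x] assms by auto
  define d where "d = e / (3 * (norm (H y) + 1))"
  have pos: "norm (H y) + 1 > 0" by (simp add: add_nonneg_pos)
  then have "d > 0" using assms by (simp add: d_def)
  moreover have "norm (S t x - x) < e" if t: "0 \<le> t" "t < d" for t
  proof -
    have "t * norm (H y) \<le> d * (norm (H y) + 1)" using t by (intro mult_mono) auto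
    also have "\<dots> = e / 3" using pos by (simp add: d_def field_simps)
    finally have *: "norm (S t y - y) \<le> e / 3" using norm_S_diff_le[OF t(1) y(1)] by linarith
    have eq: "S t x - x = (S t x - S t y) + (S t y - y) + (y - x)" by simp
    have "norm (S t x - x) \<le> norm (S t x - S t y) + norm (S t y - y) + norm (y - x)"
      unfolding eq by (intro norm_triangle_le add_mono norm_triangle_ineq order_refl)
    also have "\<dots> < e"
      using S_nonexpansive[OF t(1), of x y] y(2) * by (simp add: norm_minus_commute)
    finally show ?thesis .
  qed
  ultimately show thesis by (rule that)
qed

lemma S_split:
  assumes "0 \<le> s" "s \<le> t"
  shows "S t x = S s (S (t - s) x)"
  using S_semigroup[of s "t - s" x] assms by simp

lemma S_continuous: "continuous_on {0..} (\<lambda>t. S t x)"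
  unfolding continuous_on_iff
proof (intro ballI allI impI)
  fix t e :: real assume "t \<in> {0..}" "e > 0"
  obtain d where d: "d > 0" "\<And>t. 0 \<le> t \<Longrightarrow> t < d \<Longrightarrow> norm (S t x - x) < e"
    using S_near_zero[OF \<open>e > 0\<close>] by blast
  have ordered: "norm (S t x - S s x) < e" if "0 \<le> s" "s \<le> t" "t - s < d" for s t
  proof -
    have "norm (S t x - S s x) \<le> norm (S (t - s) x - x)"
      unfolding S_split[OF that(1,2)] using that by (intro S_nonexpansive) auto
    also have "\<dots> < e" using d(2)[of "t - s"] that by simp
    finally show ?thesis .
  qed
  have "dist (S s x) (S t x) < e" if "s \<in> {0..}" "dist s t < d" for s
    using ordered[of s t] ordered[of t s] that \<open>t \<in> {0..}\<close>
    by (cases "s \<le> t") (auto simp: dist_norm norm_minus_commute dist_real_def)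
  then show "\<exists>d>0. \<forall>s\<in>{0..}. dist s t < d \<longrightarrow> dist (S s x) (S t x) < e"
    using d(1) by blast
qed

text \<open>An increment to the right of \<open>t\<close> is the one at time 0, transported by the
  contraction \<open>S t\<close>. An increment to the left is based at the earlier time
  \<open>s\<close>, and continuity of the orbit of \<open>H x\<close> exchanges the derivative at
  \<open>s\<close> for the one at \<open>t\<close>.\<close>

lemma S_has_vector_derivative:
  assumes "x \<in> D" "t \<ge> 0"
  shows "((\<lambda>t. S t x) has_vector_derivative - S t (H x)) (at t within {0..})"
  unfolding has_vector_derivative_def has_derivative_within_alt
proof (intro conjI allI impI)
  show "bounded_linear (\<lambda>r. r *\<^sub>R - S t (H x))" by (rule bounded_linear_scaleR_left)
  fix e :: real assume "e > 0"
  then have "e / 2 > 0" by simp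
  obtain d1 where d1: "d1 > 0" "\<And>t. 0 \<le> t \<Longrightarrow> t < d1 \<Longrightarrow> norm (S t x - x + t *\<^sub>R H x) \<le> e / 2 * t"
    using S_increment_uniform[OF assms(1) \<open>e / 2 > 0\<close>] by blast
  have "continuous (at t within {0..}) (\<lambda>t. S t (H x))"
    using S_continuous assms(2) by (simp add: continuous_on_eq_continuous_within)
  then obtain d2 where d2: "d2 > 0"
      "\<And>s. s \<in> {0..} \<Longrightarrow> dist s t < d2 \<Longrightarrow> dist (S s (H x)) (S t (H x)) < e / 2"
    using \<open>e / 2 > 0\<close> unfolding continuous_within_eps_delta by metis
  have ordered: "norm (S v x - S u x + (v - u) *\<^sub>R S u (H x)) \<le> e / 2 * (v - u)"
    if "0 \<le> u" "u \<le> v" "v - u < d1" for u v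
  proof -
    have "S v x - S u x + (v - u) *\<^sub>R S u (H x) = S u (S (v - u) x - x + (v - u) *\<^sub>R H x)"
      using S_split[OF that(1,2), of x] that by (simp add: S_diff S_add S_scaleR)
    then have "norm (S v x - S u x + (v - u) *\<^sub>R S u (H x)) \<le> norm (S (v - u) x - x + (v - u) *\<^sub>R H x)"
      using norm_S_le[OF that(1)] by simp
    also have "\<dots> \<le> e / 2 * (v - u)" using d1(2)[of "v - u"] that by simp
    finally show ?thesis .
  qed
  have "norm (S s x - S t x - (s - t) *\<^sub>R - S t (H x)) \<le> e * norm (s - t)"
    if s: "s \<in> {0..}" "norm (s - t) < min d1 d2" for s
  proof (cases "t \<le> s")
    case True
    then have "norm (S s x - S t x + (s - t) *\<^sub>R S t (H x)) \<le> e / 2 * (s - t)"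
      using ordered[of t s] assms(2) s by simp
    also have "\<dots> \<le> e * (s - t)" using True \<open>e > 0\<close> by (intro mult_right_mono) auto
    finally show ?thesis using True by simp
  next
    case False
    have "S s x - S t x + (s - t) *\<^sub>R S t (H x)
        = - (S t x - S s x + (t - s) *\<^sub>R S s (H x)) + (t - s) *\<^sub>R (S s (H x) - S t (H x))"
      by (simp add: algebra_simps)
    also have "norm \<dots> \<le> e / 2 * (t - s) + (t - s) * (e / 2)"
    proof (rule norm_triangle_le[OF add_mono])
      show "norm (- (S t x - S s x + (t - s) *\<^sub>R S s (H x))) \<le> e / 2 * (t - s)"
        unfolding norm_minus_cancel using ordered[of s t] s False by simp
      show "norm ((t - s) *\<^sub>R (S s (H x) - S t (H x))) \<le> (t - s) * (e / 2)"
        using d2(2)[of s] s False by (simp add: dist_norm)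
    qed
    finally show ?thesis using False by (simp add: algebra_simps)
  qed
  then show "\<exists>d>0. \<forall>s\<in>{0..}. norm (s - t) < d \<longrightarrow>
      norm (S s x - S t x - (s - t) *\<^sub>R - S t (H x)) \<le> e * norm (s - t)"
    using d1(1) d2(1) by (intro exI[of _ "min d1 d2"]) simp
qed

lemma C0_semigroup_S: "C0_semigroup S"
  unfolding C0_semigroup_def
  using bounded_clinear_S S_zero S_semigroup S_continuous by blast

lemma S_right_derivative:
  assumes "x \<in> D"
  shows "((\<lambda>h. (S h x - x) /\<^sub>R h) \<longlongrightarrow> - H x) (at_right 0)"
proof (rule tendstoI)
  fix e :: real assume "e > 0"
  then have "e / 2 > 0" by simp
  obtain d where d: "d > 0" "\<And>t. 0 \<le> t \<Longrightarrow> t < d \<Longrightarrow> norm (S t x - x + t *\<^sub>R H x) \<le> e / 2 * t"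
    using S_increment_uniform[OF assms \<open>e / 2 > 0\<close>] by blast
  have "\<forall>\<^sub>F h in at_right 0. h \<in> {0<..<d}" using d(1) by (intro eventually_at_right_real) auto
  then show "\<forall>\<^sub>F h in at_right 0. dist ((S h x - x) /\<^sub>R h) (- H x) < e"
  proof eventually_elim
    case (elim h)
    have "dist ((S h x - x) /\<^sub>R h) (- H x) = norm ((1 / h) *\<^sub>R (S h x - x + h *\<^sub>R H x))"
      using elim by (simp add: dist_norm scaleR_add_right inverse_eq_divide)
    also have "\<dots> = (1 / h) * norm (S h x - x + h *\<^sub>R H x)" using elim by simp
    also have "\<dots> \<le> (1 / h) * (e / 2 * h)" using d(2)[of h] elim by (intro mult_left_mono) auto
    also have "\<dots> < e" using elim \<open>e > 0\<close> by simp
    finally show ?case .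
  qed
qed

text \<open>The generator of \<open>S\<close> is a dissipative extension of \<open>-H\<close>. It is not a proper one, because
  \<open>1 + H\<close> is already onto.\<close>

lemma is_generator_S: "is_generator S D (\<lambda>f. - H f)"
  unfolding is_generator_def
proof (intro allI iffI)
  fix x y assume "x \<in> D \<and> y = - H x"
  then show "((\<lambda>h. (S h x - x) /\<^sub>R h) \<longlongrightarrow> y) (at_right 0)" using S_right_derivative by simp
next
  fix x y assume lim: "((\<lambda>h. (S h x - x) /\<^sub>R h) \<longlongrightarrow> y) (at_right 0)"
  \<comment> \<open>Subtracting the known generator value at \<open>f\<close> leaves a
    \<open>z\<close> whose orbit has right derivative \<open>z\<close> at time 0. A contraction
    semigroup permits that only for \<open>z = 0\<close>.\<close>
  define f where "f = J 1 (x - y)"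
  have f: "f \<in> D" "f + H f = x - y" using J_D[of 1] J_eq[of 1] by (auto simp: f_def)
  define z where "z = x - f"
  have yz: "y - - H f = z" using f(2) by (simp add: z_def algebra_simps)
  have "((\<lambda>h. (S h x - x) /\<^sub>R h - (S h f - f) /\<^sub>R h) \<longlongrightarrow> z) (at_right 0)"
    unfolding yz[symmetric] by (intro tendsto_diff lim S_right_derivative f)
  moreover have "\<forall>\<^sub>F h in at_right 0. (S h x - x) /\<^sub>R h - (S h f - f) /\<^sub>R h = (S h z - z) /\<^sub>R h"
    using eventually_at_right_less[of "0::real"]
    by eventually_elim (simp add: z_def S_diff algebra_simps)
  ultimately have "((\<lambda>h. (S h z - z) /\<^sub>R h) \<longlongrightarrow> z) (at_right 0)"
    by (rule Lim_transform_eventually)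
  then have "((\<lambda>h. ((S h z - z) /\<^sub>R h) \<bullet> z) \<longlongrightarrow> z \<bullet> z) (at_right 0)"
    by (intro tendsto_inner tendsto_const)
  moreover have "\<forall>\<^sub>F h in at_right 0. ((S h z - z) /\<^sub>R h) \<bullet> z \<le> 0"
    using eventually_at_right_less[of "0::real"]
  proof eventually_elim
    case (elim h)
    have "S h z \<bullet> z \<le> norm (S h z) * norm z" by (rule norm_cauchy_schwarz)
    also have "\<dots> \<le> norm z * norm z" using elim by (intro mult_right_mono norm_S_le) auto
    finally have "(S h z - z) \<bullet> z \<le> 0" by (simp add: inner_diff_left power2_norm_eq_inner[symmetric] power2_eq_square)
    then show ?case using elim by (simp add: mult_nonneg_nonpos)
  qed
  ultimately have "z \<bullet> z \<le> 0" by (intro tendsto_upperbound) auto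
  then have "z = 0" using inner_gt_zero_iff[of z] by linarith
  then have "x = f" by (simp add: z_def)
  then show "x \<in> D \<and> y = - H x" using f by (simp add: eq_neg_iff_add_eq_0 add.commute)
qed

section \<open>Uniqueness of the semigroup generated by \<open>-H\<close>\<close>

context
  fixes T
  assumes T: "C0_semigroup T" "is_generator T D (\<lambda>f. - H f)"
begin

text \<open>\<open>T t\<close> commutes with the difference quotients at 0, so it preserves the set
  where they converge, and that set is \<open>D\<close>.\<close>

lemma semigroup_D:
  assumes "x \<in> D" "t \<ge> 0"
  shows "T t x \<in> D"
proof -
  have bl: "bounded_linear (T t)" using T(1) assms by (simp add: C0_semigroup_def bounded_clinear_def)
  have "((\<lambda>h. (T h x - x) /\<^sub>R h) \<longlongrightarrow> - H x) (at_right 0)"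
    using T(2) assms by (simp add: is_generator_def)
  from bounded_linear.tendsto[OF bl this]
  have "((\<lambda>h. T t ((T h x - x) /\<^sub>R h)) \<longlongrightarrow> T t (- H x)) (at_right 0)" .
  moreover have "\<forall>\<^sub>F h in at_right 0. T t ((T h x - x) /\<^sub>R h) = (T h (T t x) - T t x) /\<^sub>R h"
    using eventually_at_right_less[of "0::real"]
  proof eventually_elim
    case (elim h)
    have "T t (T h x) = T h (T t x)"
      using T(1) assms elim by (metis C0_semigroup_def add.commute less_imp_le)
    then show ?case by (simp add: linear_scale linear_diff bounded_linear.linear[OF bl])
  qed
  ultimately have "((\<lambda>h. (T h (T t x) - T t x) /\<^sub>R h) \<longlongrightarrow> T t (- H x)) (at_right 0)"
    by (rule Lim_transform_eventually)
  then show ?thesis using T(2) by (simp add: is_generator_def)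
qed

lemma semigroup_right_derivative:
  assumes "x \<in> D" "t \<ge> 0"
  shows "((\<lambda>h. (T (t + h) x - T t x) /\<^sub>R h) \<longlongrightarrow> - H (T t x)) (at_right 0)"
proof -
  have "((\<lambda>h. (T h (T t x) - T t x) /\<^sub>R h) \<longlongrightarrow> - H (T t x)) (at_right 0)"
    using T(2) semigroup_D[OF assms] by (simp add: is_generator_def)
  moreover have "\<forall>\<^sub>F h in at_right 0. (T h (T t x) - T t x) /\<^sub>R h = (T (t + h) x - T t x) /\<^sub>R h"
    using eventually_at_right_less[of "0::real"]
  proof eventually_elim
    case (elim h)
    have "T h (T t x) = T (t + h) x"
      using T(1) assms elim by (metis C0_semigroup_def add.commute less_imp_le)
    then show ?case by simp
  qed
  ultimately show ?thesis by (rule Lim_transform_eventually)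
qed

end

text \<open>The difference of two orbits satisfies w' = -Hw from the right, and accretivity makes
  its squared norm nonincreasing. This replaces contractivity, which is unknown for
  \<open>T\<close>. The description in \<open>exp_semigroup\<close> thereby denotes
  \<open>S t\<close>.\<close>

lemma semigroup_unique:
  assumes T: "C0_semigroup T" "is_generator T D (\<lambda>f. - H f)" and "t \<ge> 0"
  shows "T t = S t"
proof -
  have on_D: "T t x = S t x" if x: "x \<in> D" for x
  proof -
    define w where "w s = T s x - S s x" for s
    define \<phi> where "\<phi> s = w s \<bullet> w s" for s
    have wD: "w s \<in> D" and Hw: "H (w s) = H (T s x) - H (S s x)" if "s \<ge> 0" for s
      using semigroup_D[OF T x that] S_D[OF that x] by (auto simp: w_def diff_D H_diff)
    have quot: "((\<lambda>h. (w (s + h) - w s) /\<^sub>R h) \<longlongrightarrow> - H (w s)) (at_right 0)" if "s \<ge> 0" for s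
    proof -
      have "((\<lambda>h. (T (s + h) x - T s x) /\<^sub>R h - (S (s + h) x - S s x) /\<^sub>R h)
          \<longlongrightarrow> - H (T s x) - - H (S s x)) (at_right 0)"
        by (intro tendsto_diff semigroup_right_derivative T C0_semigroup_S is_generator_S x that)
      then show ?thesis unfolding Hw[OF that] by (simp add: w_def algebra_simps)
    qed
    have "\<phi> t \<le> \<phi> 0"
    proof (rule right_derivative_nonpos_imp_le[where \<phi>=\<phi> and a=0 and b=t])
      have "continuous_on {0..} (\<lambda>s. T s x)" using T(1) by (simp add: C0_semigroup_def)
      then have "continuous_on {0..} w" unfolding w_def by (intro continuous_intros S_continuous)
      then show "continuous_on {0..t} \<phi>" unfolding \<phi>_def
        by (intro continuous_intros) (auto intro: continuous_on_subset)
      fix s assume s: "0 \<le> s" "s < t"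
      \<comment> \<open>Expresses \<open>w (s + h)\<close> through the quotient itself, so that the
        increment of \<phi>, written as the inner product of \<open>w (s + h) - w s\<close> and
        \<open>w (s + h) + w s\<close>, gets its limit from \<open>quot\<close>.\<close>
      have "((\<lambda>h. w s + h *\<^sub>R ((w (s + h) - w s) /\<^sub>R h)) \<longlongrightarrow> w s + 0 *\<^sub>R - H (w s)) (at_right 0)"
        by (intro tendsto_intros quot s)
      from tendsto_inner[OF quot[OF s(1)] tendsto_add[OF tendsto_const[of "w s"] this]]
      have "((\<lambda>h. ((w (s + h) - w s) /\<^sub>R h) \<bullet> (w s + (w s + h *\<^sub>R ((w (s + h) - w s) /\<^sub>R h))))
          \<longlongrightarrow> (- H (w s)) \<bullet> (w s + (w s + 0 *\<^sub>R - H (w s)))) (at_right 0)"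
        .
      moreover have "\<forall>\<^sub>F h in at_right 0. ((w (s + h) - w s) /\<^sub>R h) \<bullet> (w s + (w s + h *\<^sub>R ((w (s + h) - w s) /\<^sub>R h)))
          = (\<phi> (s + h) - \<phi> s) / h"
        using eventually_at_right_less[of "0::real"]
      proof eventually_elim
        case (elim h)
        have "h *\<^sub>R ((w (s + h) - w s) /\<^sub>R h) = w (s + h) - w s" using elim by simp
        moreover have "(w (s + h) - w s) \<bullet> (w s + (w s + (w (s + h) - w s))) = \<phi> (s + h) - \<phi> s"
          by (simp add: \<phi>_def inner_diff_left inner_diff_right inner_add_right inner_commute)
        ultimately show ?case by (simp only: inner_scaleR_left divide_inverse mult.commute)
      qed
      ultimately have "((\<lambda>h. (\<phi> (s + h) - \<phi> s) / h) \<longlongrightarrow> (- H (w s)) \<bullet> (w s + (w s + 0 *\<^sub>R - H (w s)))) (at_right 0)"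
        by (rule Lim_transform_eventually)
      moreover have "(- H (w s)) \<bullet> (w s + (w s + 0 *\<^sub>R - H (w s))) \<le> 0"
        using accretive[OF wD[OF s(1)]] by (simp add: inner_add_right)
      ultimately show "\<exists>L\<le>0. ((\<lambda>h. (\<phi> (s + h) - \<phi> s) / h) \<longlongrightarrow> L) (at_right 0)" by blast
    qed (use \<open>t \<ge> 0\<close> in auto)
    moreover have "w 0 = 0" using T(1) by (simp add: w_def C0_semigroup_def S_zero)
    ultimately have "w t \<bullet> w t \<le> 0" by (simp add: \<phi>_def)
    then have "w t = 0" using inner_gt_zero_iff[of "w t"] by linarith
    then show ?thesis by (simp add: w_def)
  qed
  have "closed {x. T t x = S t x}"
  proof (rule closed_Collect_eq)
    show "continuous_on UNIV (T t)" using T(1) \<open>t \<ge> 0\<close>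
      by (simp add: C0_semigroup_def bounded_clinear_def linear_continuous_on)
    show "continuous_on UNIV (S t)" using bounded_clinear_S[OF \<open>t \<ge> 0\<close>]
      by (simp add: bounded_clinear_def linear_continuous_on)
  qed
  then show ?thesis using dense_extend[of "\<lambda>x. T t x = S t x"] on_D by blast
qed

lemma exp_semigroup_eq: "t \<ge> 0 \<Longrightarrow> exp_semigroup D H t = S t"
  unfolding exp_semigroup_def
  using C0_semigroup_S is_generator_S semigroup_unique by (intro the_equality) blast+

end

subsection \<open>The gap estimate\<close>

text \<open>Uniform continuity of the derivative makes the first-order remainder uniform in the base
  point. It serves twice below: for difference quotients of the cut-off orbit and for comparing a
  Riemann sum with its integral.\<close>

lemma C1_uniform_linearization:
  fixes u u' :: "real \<Rightarrow> 'a::real_normed_vector"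
  assumes u: "\<And>t. t \<in> {a..b} \<Longrightarrow> (u has_vector_derivative u' t) (at t within {a..b})"
    and u': "continuous_on {a..b} u'" and "e > 0"
  obtains d where "d > 0"
    "\<And>s t. s \<in> {a..b} \<Longrightarrow> t \<in> {a..b} \<Longrightarrow> \<bar>t - s\<bar> < d \<Longrightarrow>
      norm (u t - u s - (t - s) *\<^sub>R u' s) \<le> e * \<bar>t - s\<bar>"
proof -
  have "uniformly_continuous_on {a..b} u'" using u' by (intro compact_uniformly_continuous) auto
  then obtain d where d: "d > 0"
      "\<And>s t. s \<in> {a..b} \<Longrightarrow> t \<in> {a..b} \<Longrightarrow> dist t s < d \<Longrightarrow> dist (u' t) (u' s) < e"
    using \<open>e > 0\<close> unfolding uniformly_continuous_on_def by metis
  have "norm (u t - u s - (t - s) *\<^sub>R u' s) \<le> norm (t - s) * e"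
    if st: "s \<in> {a..b}" "t \<in> {a..b}" "\<bar>t - s\<bar> < d" for s t
  proof (rule vector_differentiable_bound_linearization[where S="closed_segment s t"])
    have sub: "closed_segment s t \<subseteq> {a..b}" using st by (intro closed_segment_subset) auto
    show "(u has_vector_derivative u' r) (at r within closed_segment s t)"
      if "r \<in> closed_segment s t" for r
      using u[of r] that sub by (meson has_vector_derivative_within_subset subsetD)
    show "norm (u' r - u' s) \<le> e" if "r \<in> closed_segment s t" for r
    proof -
      have "dist r s \<le> dist t s" using segment_bound(1)[OF that] by (simp add: dist_norm norm_minus_commute)
      then have "dist r s < d" using st(3) by (simp add: dist_real_def)
      moreover have "r \<in> {a..b}" using that sub by blast
      ultimately show ?thesis using d(2)[OF st(1), of r] by (simp add: dist_norm less_imp_le)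
    qed
  qed auto
  then show thesis using that[OF d(1)] by (simp add: mult.commute)
qed

lemma continuous_on_Icc_bounded:
  fixes f :: "real \<Rightarrow> 'a::real_normed_vector"
  assumes "continuous_on {a..b} f"
  obtains B where "B \<ge> 0" "\<And>t. t \<in> {a..b} \<Longrightarrow> norm (f t) \<le> B"
proof -
  have "bounded (f ` {a..b})"
    using compact_continuous_image[OF assms] by (intro compact_imp_bounded) auto
  then obtain B where "B > 0" "\<forall>y \<in> f ` {a..b}. norm y \<le> B" using bounded_pos by blast
  then show thesis using that[of B] by auto
qed

context m_accretive_operator
begin

context
  fixes p :: real
  assumes p_nonneg: "p \<ge> 0"
    and gap: "\<And>f s. f \<in> D \<Longrightarrow> p * norm f \<le> norm (H f - (\<i> * complex_of_real s) *\<^sub>C f)"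
begin

text \<open>The symbol of the symmetric difference quotient is purely imaginary, so that each discrete
  Fourier mode sees \<open>H\<close> shifted along the imaginary axis.\<close>

lemma discrete_gap_estimate:
  fixes u g :: "nat \<Rightarrow> 'a"
  assumes uD: "\<And>j. u j \<in> D" and u0: "u 0 = 0" "u (Suc m) = 0"
    and g0: "g 0 = c *\<^sub>R (u 1 - u m) + H (u 0)"
    and gSuc: "\<And>j. g (Suc j) = c *\<^sub>R (u (Suc (Suc j)) - u j) + H (u (Suc j))"
  shows "p\<^sup>2 * (\<Sum>j<Suc m. (norm (u j))\<^sup>2) \<le> (\<Sum>j<Suc m. (norm (g j))\<^sup>2)"
proof -
  define n where "n = Suc m"
  define F where "F k = (\<Sum>j<n. root_of_unity n k ^ j *\<^sub>C u j)" for k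
  define G where "G k = (\<Sum>j<n. root_of_unity n k ^ j *\<^sub>C g j)" for k
  \<comment> \<open>The cyclic predecessor: index 0 looks back to \<open>m\<close>.\<close>
  define b where "b j = (case j of 0 \<Rightarrow> u m | Suc i \<Rightarrow> u i)" for j
  have g: "g j = c *\<^sub>R (u (Suc j) - b j) + H (u j)" for j
    by (cases j) (auto simp: b_def g0 gSuc)
  have mode: "p * norm (F k) \<le> norm (G k)" for k
  proof -
    define z where "z = root_of_unity n k"
    have "n > 0" by (simp add: n_def)
    then have "z ^ n = cis (2 * pi * of_int (int k))"
      by (simp add: z_def root_of_unity_def Complex.DeMoivre)
    also have "\<dots> = 1" by (rule cis_multiple_2pi) simp
    finally have zn: "z ^ Suc m = 1" by (simp only: n_def)
    have "cmod z = 1" by (simp add: z_def root_of_unity_def)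
    then have "z * cnj z = 1" using complex_norm_square[of z] by simp
    then have "inverse z = cnj z" by (rule inverse_unique)
    have F: "F k = (\<Sum>j<Suc m. z ^ j *\<^sub>C u j)" by (simp only: F_def z_def n_def)
    have FD: "F k \<in> D" unfolding F_def by (intro sum_D scaleC_D uD)
    have HF: "(\<Sum>j<Suc m. z ^ j *\<^sub>C H (u j)) = H (F k)"
      unfolding F by (subst H_sum) (auto simp: scaleC_D uD H_scaleC)
    have "(\<Sum>j<Suc m. z ^ j *\<^sub>C b j) = u m + (\<Sum>j<m. z ^ Suc j *\<^sub>C u j)"
      by (subst sum.lessThan_Suc_shift) (simp add: b_def)
    also have "\<dots> = z *\<^sub>C F k" unfolding F by (rule dft_shift(2)[OF zn u0])
    finally have b: "(\<Sum>j<Suc m. z ^ j *\<^sub>C b j) = z *\<^sub>C F k" .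
    have "G k = c *\<^sub>R ((\<Sum>j<Suc m. z ^ j *\<^sub>C u (Suc j)) - (\<Sum>j<Suc m. z ^ j *\<^sub>C b j))
        + (\<Sum>j<Suc m. z ^ j *\<^sub>C H (u j))"
      unfolding G_def z_def[symmetric] n_def[symmetric] g
      by (simp only: scaleC_add_right scaleC_scaleR scaleC_diff_right sum.distrib sum_subtractf
          scaleR_sum_right[symmetric])
    also have "\<dots> = c *\<^sub>R ((inverse z - z) *\<^sub>C F k) + H (F k)"
      unfolding b HF F dft_shift(1)[OF zn u0] by (simp only: scaleC_diff_left)
    also have "\<dots> = H (F k) + (of_real c * (inverse z - z)) *\<^sub>C F k"
      by (simp only: scaleC_of_real[symmetric] scaleC_scaleC add.commute)
    also have "of_real c * (inverse z - z) = - (\<i> * complex_of_real (2 * c * Im z))"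
      unfolding \<open>inverse z = cnj z\<close> by (simp add: complex_eq_iff)
    finally show ?thesis using gap[OF FD, of "2 * c * Im z"] by simp
  qed
  have "real n * (p\<^sup>2 * (\<Sum>j<n. (norm (u j))\<^sup>2)) = (\<Sum>k<n. (p * norm (F k))\<^sup>2)"
    using parseval_dft[of n u] by (simp add: F_def power_mult_distrib sum_distrib_left[symmetric])
  also have "\<dots> \<le> (\<Sum>k<n. (norm (G k))\<^sup>2)"
    by (intro sum_mono power_mono mode mult_nonneg_nonneg p_nonneg) auto
  also have "\<dots> = real n * (\<Sum>j<n. (norm (g j))\<^sup>2)" using parseval_dft[of n g] by (simp add: G_def)
  finally show ?thesis by (simp add: n_def del: sum.lessThan_Suc)
qed

text \<open>Apply the discrete inequality to equidistant samples of \<psi> S x with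
  \<open>c = 1 / (2 * \<delta>)\<close>. Since u' + Hu = v, its right-hand side approximates samples
  of \<open>v\<close>, and the factor \<delta> turns sums into integrals. The inequality results up
  to an error \<open>e * K\<close> with \<open>e\<close> arbitrarily small.\<close>

lemma gap_integral_estimate:
  fixes \<psi> \<psi>' :: "real \<Rightarrow> real"
  assumes x: "x \<in> D" and "M > 0"
    and \<psi>: "\<And>t. t \<in> {0..M} \<Longrightarrow> (\<psi> has_real_derivative \<psi>' t) (at t within {0..M})"
    and \<psi>': "continuous_on {0..M} \<psi>'" and \<psi>0: "\<psi> 0 = 0" "\<psi> M = 0"
  shows "0 \<le> integral {0..M} (\<lambda>t. ((\<psi>' t)\<^sup>2 - p\<^sup>2 * (\<psi> t)\<^sup>2) * (norm (S t x))\<^sup>2)"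
proof -
  define \<phi> where "\<phi> t = ((\<psi>' t)\<^sup>2 - p\<^sup>2 * (\<psi> t)\<^sup>2) * (norm (S t x))\<^sup>2" for t
  define \<Phi> where "\<Phi> t = integral {0..t} \<phi>" for t
  define u where "u t = \<psi> t *\<^sub>R S t x" for t
  define v where "v t = \<psi>' t *\<^sub>R S t x" for t
  define u' where "u' t = v t - \<psi> t *\<^sub>R S t (H x)" for t
  have S_cont: "continuous_on {0..M} (\<lambda>t. S t y)" for y
    by (rule continuous_on_subset[OF S_continuous]) auto
  have \<psi>_cont: "continuous_on {0..M} \<psi>"
    by (rule DERIV_continuous_on) (rule \<psi>)
  have v_cont: "continuous_on {0..M} v" unfolding v_def by (intro continuous_intros S_cont \<psi>')
  have u'_cont: "continuous_on {0..M} u'"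
    unfolding u'_def by (intro continuous_intros v_cont S_cont \<psi>_cont)
  have u_deriv: "(u has_vector_derivative u' t) (at t within {0..M})" if "t \<in> {0..M}" for t
  proof -
    have "((\<lambda>t. S t x) has_vector_derivative - S t (H x)) (at t within {0..M})"
      using that by (intro has_vector_derivative_within_subset[OF S_has_vector_derivative] x) auto
    from has_vector_derivative_scaleR[OF \<psi>[OF that] this]
    show ?thesis by (simp add: u_def[abs_def] u'_def v_def)
  qed
  have \<phi>_cont: "continuous_on {0..M} \<phi>"
    unfolding \<phi>_def by (intro continuous_intros S_cont \<psi>' \<psi>_cont)
  have \<phi>_eq: "\<phi> t = (norm (v t))\<^sup>2 - p\<^sup>2 * (norm (u t))\<^sup>2" for t
    by (simp add: \<phi>_def u_def v_def power_mult_distrib algebra_simps)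
  have \<Phi>_deriv: "(\<Phi> has_vector_derivative \<phi> t) (at t within {0..M})" if "t \<in> {0..M}" for t
    unfolding \<Phi>_def by (rule integral_has_vector_derivative[OF \<phi>_cont that])
  obtain L where L: "L \<ge> 0" "\<And>t. t \<in> {0..M} \<Longrightarrow> norm (v t) \<le> L"
    using continuous_on_Icc_bounded[OF v_cont] by blast
  obtain B where B: "B \<ge> 0" "\<And>t. t \<in> {0..M} \<Longrightarrow> norm (u' t) \<le> B"
    using continuous_on_Icc_bounded[OF u'_cont] by blast
  \<comment> \<open>Three errors, each divided by \<open>e\<close>: the junction sample, the
    difference quotients accumulated over the interval, and the Riemann sum.\<close>
  define K where "K = (B + 1)\<^sup>2 + M * (2 * L + 1) + M"
  have "K > 0" using B(1) L(1) \<open>M > 0\<close> unfolding K_def by (intro add_nonneg_pos add_nonneg_nonneg) auto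
  have approx: "- (e * K) \<le> \<Phi> M" if e: "e > 0" "e \<le> 1" for e
  proof -
    obtain d1 where d1: "d1 > 0" "\<And>s t. s \<in> {0..M} \<Longrightarrow> t \<in> {0..M} \<Longrightarrow> \<bar>t - s\<bar> < d1 \<Longrightarrow>
        norm (u t - u s - (t - s) *\<^sub>R u' s) \<le> e * \<bar>t - s\<bar>"
      using C1_uniform_linearization[OF u_deriv u'_cont e(1)] by blast
    obtain d2 where d2: "d2 > 0" "\<And>s t. s \<in> {0..M} \<Longrightarrow> t \<in> {0..M} \<Longrightarrow> \<bar>t - s\<bar> < d2 \<Longrightarrow>
        norm (\<Phi> t - \<Phi> s - (t - s) *\<^sub>R \<phi> s) \<le> e * \<bar>t - s\<bar>"
      using C1_uniform_linearization[OF \<Phi>_deriv \<phi>_cont e(1)] by blast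
    have "min e (min d1 d2) / M > 0" using e d1(1) d2(1) \<open>M > 0\<close> by simp
    then obtain m where m: "inverse (real (Suc m)) < min e (min d1 d2) / M"
      using reals_Archimedean by blast
    define \<delta> where "\<delta> = M / real (Suc m)"
    have \<delta>: "\<delta> > 0" "\<delta> < e" "\<delta> < d1" "\<delta> < d2"
      using m \<open>M > 0\<close> by (auto simp: \<delta>_def field_simps)
    have M_eq: "M = real (Suc m) * \<delta>" by (simp add: \<delta>_def)
    define t where "t j = real j * \<delta>" for j
    have t_in: "t j \<in> {0..M}" if "j \<le> Suc m" for j
      using that \<delta>(1) unfolding t_def M_eq by (auto intro!: mult_right_mono)
    have t_Suc: "t (Suc j) - t j = \<delta>" for j by (simp add: t_def algebra_simps)
    \<comment> \<open>The value 0 beyond the last node keeps every sample in \<open>D\<close>, as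
      \<open>discrete_gap_estimate\<close> asks of all indices.\<close>
    define U where "U j = (if j \<le> Suc m then u (t j) else 0)" for j
    define G where "G j = (1 / (2 * \<delta>)) *\<^sub>R (U (Suc j) - (case j of 0 \<Rightarrow> U m | Suc i \<Rightarrow> U i)) + H (U j)" for j
    have uD: "u s \<in> D" and Hu: "H (u s) = \<psi> s *\<^sub>R S s (H x)" if "s \<ge> 0" for s
      using S_D[OF that x] by (auto simp: u_def scaleR_D H_scaleR)
    have U0: "U 0 = 0" "U (Suc m) = 0"
      using \<psi>0 M_eq by (auto simp: U_def u_def t_def)
    have gap_sum: "p\<^sup>2 * (\<Sum>j<Suc m. (norm (U j))\<^sup>2) \<le> (\<Sum>j<Suc m. (norm (G j))\<^sup>2)"
    proof (rule discrete_gap_estimate[where c="1 / (2 * \<delta>)"])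
      show "U j \<in> D" for j using t_in[of j] uD[of "t j"] by (auto simp: U_def)
    qed (use U0 in \<open>auto simp: G_def\<close>)
    have step: "norm (u (t j) - u (t i) - (t j - t i) *\<^sub>R u' (t i)) \<le> e * \<delta>"
      if "i = Suc j \<or> j = Suc i" "i \<le> Suc m" "j \<le> Suc m" for i j
    proof -
      have "\<bar>t j - t i\<bar> = \<delta>" using that(1) t_Suc[of i] t_Suc[of j] \<delta>(1) by auto
      then show ?thesis using d1(2)[OF t_in[OF that(2)] t_in[OF that(3)]] \<delta> by simp
    qed
    \<comment> \<open>Next to a zero of \<open>u\<close> the samples are of order \<delta>, which
      keeps the quotient across the junction bounded.\<close>
    have edge: "norm (u (t j)) \<le> \<delta> * (B + 1)"
      if "i = Suc j \<or> j = Suc i" "i \<le> Suc m" "j \<le> Suc m" "u (t i) = 0" for i j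
    proof -
      have abs: "\<bar>t j - t i\<bar> = \<delta>" using that(1) t_Suc[of i] t_Suc[of j] \<delta>(1) by auto
      have "norm (u (t j)) \<le> norm (u (t j) - u (t i) - (t j - t i) *\<^sub>R u' (t i)) + norm ((t j - t i) *\<^sub>R u' (t i))"
        using norm_triangle_ineq[of "u (t j) - (t j - t i) *\<^sub>R u' (t i)" "(t j - t i) *\<^sub>R u' (t i)"] that(4) by simp
      also have "\<dots> \<le> e * \<delta> + \<delta> * B"
        using step[OF that(1-3)] B(2)[OF t_in[OF that(2)]] abs \<delta>(1) by (intro add_mono) auto
      also have "\<dots> \<le> \<delta> * (B + 1)" using e \<delta>(1) by (simp add: algebra_simps)
      finally show ?thesis .
    qed
    \<comment> \<open>Here the quotient joins the two ends of the interval and need not approximate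
      \<open>v 0\<close>. A bound suffices for this single sample, which is later multiplied by
      \<delta>.\<close>
    have G0: "(norm (G 0))\<^sup>2 \<le> (B + 1)\<^sup>2"
    proof (rule power_mono)
      have eq: "norm (G 0) = norm (U 1 - U m) / (2 * \<delta>)"
        using \<delta>(1) U0 by (simp add: G_def)
      have "norm (U 1 - U m) \<le> norm (u (t 1)) + norm (u (t m))"
        using norm_triangle_ineq4[of "u (t 1)" "u (t m)"] by (simp add: U_def)
      also have "\<dots> \<le> \<delta> * (B + 1) + \<delta> * (B + 1)"
        using edge[of 0 1] edge[of "Suc m" m] U0 by (intro add_mono) (auto simp: U_def)
      finally show "norm (G 0) \<le> B + 1"
        unfolding eq using \<delta>(1) by (simp add: pos_divide_le_eq algebra_simps)
    qed simp
    have GSuc: "(norm (G (Suc i)))\<^sup>2 \<le> (norm (v (t (Suc i))))\<^sup>2 + e * (2 * L + 1)" if "i < m" for i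
    proof -
      define a b c where "a = t i" and "b = t (Suc i)" and "c = t (Suc (Suc i))"
      have ab: "a - b = - \<delta>" "c - b = \<delta>" using t_Suc[of i] t_Suc[of "Suc i"] by (auto simp: a_def b_def c_def)
      have bM: "b \<in> {0..M}" using t_in[of "Suc i"] that by (simp add: b_def)
      have "norm (u a - u b - (a - b) *\<^sub>R u' b) \<le> e * \<delta>" unfolding a_def b_def using that by (intro step) auto
      then have 1: "norm (- (u a - u b + \<delta> *\<^sub>R u' b)) \<le> e * \<delta>" unfolding ab norm_minus_cancel by simp
      have "norm (u c - u b - (c - b) *\<^sub>R u' b) \<le> e * \<delta>" unfolding b_def c_def using that by (intro step) auto
      then have 2: "norm (u c - u b - \<delta> *\<^sub>R u' b) \<le> e * \<delta>" unfolding ab .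
      \<comment> \<open>The \<open>H\<close> term cancels against the one inside
        \<open>u' b\<close>. What remains is the error of the symmetric quotient, split into those
        of its two one-sided halves.\<close>
      have "G (Suc i) - v b = (1 / (2 * \<delta>)) *\<^sub>R (u c - u a) - u' b"
        using that bM by (simp add: G_def U_def a_def b_def c_def Hu u'_def)
      also have "\<dots> = (1 / (2 * \<delta>)) *\<^sub>R ((u c - u b - \<delta> *\<^sub>R u' b) + - (u a - u b + \<delta> *\<^sub>R u' b))"
      proof -
        have eq: "(u c - u b - \<delta> *\<^sub>R u' b) + - (u a - u b + \<delta> *\<^sub>R u' b) = (u c - u a) - (2 * \<delta>) *\<^sub>R u' b"
          by (simp add: scaleR_2[symmetric] flip: scaleR_scaleR)
        show ?thesis unfolding eq using \<delta>(1) by (simp add: scaleR_diff_right)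
      qed
      also have "norm \<dots> \<le> (1 / (2 * \<delta>)) * (e * \<delta> + e * \<delta>)"
        unfolding norm_scaleR using \<delta>(1) by (intro mult_mono norm_triangle_le[OF add_mono[OF 2 1]]) auto
      also have "\<dots> = e" using \<delta>(1) by simp
      finally have "norm (G (Suc i)) \<le> norm (v b) + e"
        using norm_triangle_sub[of "G (Suc i)" "v b"] by linarith
      then have "(norm (G (Suc i)))\<^sup>2 \<le> (norm (v b) + e)\<^sup>2" by (intro power_mono) auto
      also have "\<dots> = (norm (v b))\<^sup>2 + e * (2 * norm (v b) + e)" by (simp add: power2_eq_square algebra_simps)
      also have "\<dots> \<le> (norm (v b))\<^sup>2 + e * (2 * L + 1)"
        using e L(2)[OF bM] by (intro add_left_mono mult_left_mono add_mono) auto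
      finally show ?thesis by (simp add: b_def)
    qed
    have "p\<^sup>2 * (\<Sum>j<Suc m. (norm (u (t j)))\<^sup>2) = p\<^sup>2 * (\<Sum>j<Suc m. (norm (U j))\<^sup>2)"
      by (intro arg_cong[where f="\<lambda>r. p\<^sup>2 * r"] sum.cong) (auto simp: U_def)
    also have "\<dots> \<le> (norm (G 0))\<^sup>2 + (\<Sum>i<m. (norm (G (Suc i)))\<^sup>2)"
      using gap_sum by (simp only: sum.lessThan_Suc_shift)
    also have "\<dots> \<le> (B + 1)\<^sup>2 + (\<Sum>i<m. (norm (v (t (Suc i))))\<^sup>2 + e * (2 * L + 1))"
      by (intro add_mono G0 sum_mono GSuc) auto
    also have "\<dots> \<le> (B + 1)\<^sup>2 + (\<Sum>j<Suc m. (norm (v (t j)))\<^sup>2) + real (Suc m) * (e * (2 * L + 1))"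
    proof -
      have "0 \<le> e * (2 * L + 1)" using e L(1) by simp
      then show ?thesis
        unfolding sum.lessThan_Suc_shift by (simp add: sum.distrib distrib_right)
    qed
    finally have "- ((B + 1)\<^sup>2) - real (Suc m) * (e * (2 * L + 1)) \<le> (\<Sum>j<Suc m. \<phi> (t j))"
      unfolding \<phi>_eq sum_subtractf sum_distrib_left[symmetric] by linarith
    from mult_left_mono[OF this less_imp_le[OF \<delta>(1)]]
    have sum_lower: "- (\<delta> * (B + 1)\<^sup>2) - M * (e * (2 * L + 1)) \<le> \<delta> * (\<Sum>j<Suc m. \<phi> (t j))"
      by (simp add: M_eq algebra_simps del: sum.lessThan_Suc of_nat_Suc)
    \<comment> \<open>The sum is compared with increments of the primitive \<Phi>, which
      telescope.\<close>
    have "\<delta> * (\<Sum>j<Suc m. \<phi> (t j)) - e * M = (\<Sum>j<Suc m. \<delta> * \<phi> (t j) - e * \<delta>)"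
      by (simp add: sum_subtractf sum_distrib_left M_eq del: sum.lessThan_Suc of_nat_Suc)
    also have "\<dots> \<le> (\<Sum>j<Suc m. \<Phi> (t (Suc j)) - \<Phi> (t j))"
    proof (rule sum_mono)
      fix j assume "j \<in> {..<Suc m}"
      then have "norm (\<Phi> (t (Suc j)) - \<Phi> (t j) - (t (Suc j) - t j) *\<^sub>R \<phi> (t j)) \<le> e * \<bar>t (Suc j) - t j\<bar>"
        using \<delta>(1,4) by (intro d2(2) t_in) (auto simp: t_Suc)
      then show "\<delta> * \<phi> (t j) - e * \<delta> \<le> \<Phi> (t (Suc j)) - \<Phi> (t j)"
        unfolding t_Suc using \<delta>(1) by (simp add: abs_le_iff)
    qed
    also have "\<dots> = \<Phi> M - \<Phi> 0"
      by (subst sum_lessThan_telescope) (simp add: t_def M_eq)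
    finally have "\<delta> * (\<Sum>j<Suc m. \<phi> (t j)) - e * M \<le> \<Phi> M" by (simp add: \<Phi>_def)
    moreover have "\<delta> * (B + 1)\<^sup>2 \<le> e * (B + 1)\<^sup>2" using \<delta>(2) by (intro mult_right_mono) auto
    moreover have "e * K = e * (B + 1)\<^sup>2 + M * (e * (2 * L + 1)) + e * M"
      by (simp add: K_def algebra_simps)
    ultimately show ?thesis using sum_lower by linarith
  qed
  have "0 \<le> \<Phi> M"
  proof (rule ccontr)
    assume "\<not> 0 \<le> \<Phi> M"
    define e where "e = min 1 (- \<Phi> M / (2 * K))"
    have "e > 0" "e \<le> 1" using \<open>\<not> 0 \<le> \<Phi> M\<close> \<open>K > 0\<close> by (auto simp: e_def divide_neg_pos)
    have "e * K \<le> - \<Phi> M / (2 * K) * K" using \<open>K > 0\<close> by (intro mult_right_mono) (auto simp: e_def)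
    also have "\<dots> = - \<Phi> M / 2" using \<open>K > 0\<close> by simp
    finally show False using approx[OF \<open>e > 0\<close> \<open>e \<le> 1\<close>] \<open>\<not> 0 \<le> \<Phi> M\<close> by linarith
  qed
  then show ?thesis by (simp add: \<Phi>_def \<phi>_def[abs_def])
qed

end
end

subsection \<open>The extremal test function\<close>

lemma has_real_derivative_glue:
  fixes f g :: "real \<Rightarrow> real"
  assumes f: "\<And>x. (f has_real_derivative f' x) (at x)" and g: "\<And>x. (g has_real_derivative g' x) (at x)"
    and "f a = g a" "f' a = g' a"
  shows "((\<lambda>x. if x \<le> a then f x else g x) has_real_derivative (if x \<le> a then f' x else g' x)) (at x)"
proof -
  have closures: "closure {..a} = {..a}" "closure {a..} = {a..}" by (auto intro: closure_closed)
  have "((\<lambda>x. if x \<in> {..a} then f x else g x) has_vector_derivative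
      (if x \<in> {..a} then f' x else g' x)) (at x within UNIV)"
  proof (rule has_vector_derivative_If_within_closures[where T="{a..}"])
    show "(f has_vector_derivative f' x) (at x within {..a} \<union> closure {..a} \<inter> closure {a..})"
      using f[of x] by (simp add: has_real_derivative_iff_has_vector_derivative has_vector_derivative_at_within)
    show "(g has_vector_derivative g' x) (at x within {a..} \<union> closure {..a} \<inter> closure {a..})"
      using g[of x] by (simp add: has_real_derivative_iff_has_vector_derivative has_vector_derivative_at_within)
  next
    assume "x \<in> closure {..a}" "x \<in> closure {a..}"
    then have "x = a" by (simp add: closures)
    then show "f x = g x" "f' x = g' x" using assms(3,4) by simp_all
  qed auto
  then show ?thesis by (simp add: has_real_derivative_iff_has_vector_derivative)
qed

text \<open>The extremal test function for the gap estimate with \<open>p = 1\<close>. The quantity \<open>w'\<^sup>2 - w\<^sup>2\<close> vanishes on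
  the exponential piece, which carries the decay. The
  trigonometric pieces each take \<open>\<pi>/4\<close> off the exponent.\<close>

definition profile :: "real \<Rightarrow> real \<Rightarrow> real"
  where "profile \<tau> \<theta> = (if \<theta> \<le> pi / 4 then sin \<theta> else if \<theta> \<le> \<tau> - pi / 4
    then sqrt 2 / 2 * exp (\<theta> - pi / 4) else exp (\<tau> - pi / 2) * cos (\<theta> - \<tau>))"

definition profile' :: "real \<Rightarrow> real \<Rightarrow> real"
  where "profile' \<tau> \<theta> = (if \<theta> \<le> pi / 4 then cos \<theta> else if \<theta> \<le> \<tau> - pi / 4
    then sqrt 2 / 2 * exp (\<theta> - pi / 4) else - (exp (\<tau> - pi / 2) * sin (\<theta> - \<tau>)))"

context
  fixes \<tau> :: real
  assumes \<tau>: "pi / 2 \<le> \<tau>"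
begin

text \<open>The pieces of the definition are half-open, while the integrals below run over closed
  ones. At \<open>pi / 4\<close> sine and cosine are both \<open>sqrt 2 / 2\<close>, so values and
  slopes agree.\<close>

lemma profile_mid:
  assumes "pi / 4 \<le> \<theta>" "\<theta> \<le> \<tau> - pi / 4"
  shows "profile \<tau> \<theta> = sqrt 2 / 2 * exp (\<theta> - pi / 4)"
    and "profile' \<tau> \<theta> = sqrt 2 / 2 * exp (\<theta> - pi / 4)"
proof -
  have "profile \<tau> \<theta> = sqrt 2 / 2 * exp (\<theta> - pi / 4) \<and>
      profile' \<tau> \<theta> = sqrt 2 / 2 * exp (\<theta> - pi / 4)"
  proof (cases "\<theta> = pi / 4")
    case True
    show ?thesis unfolding True by (simp add: profile_def profile'_def sin_45 cos_45)
  next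
    case False
    then have "\<not> \<theta> \<le> pi / 4" using assms by simp
    then show ?thesis using assms(2) by (simp only: profile_def profile'_def if_True if_False simp_thms)
  qed
  then show "profile \<tau> \<theta> = sqrt 2 / 2 * exp (\<theta> - pi / 4)"
    "profile' \<tau> \<theta> = sqrt 2 / 2 * exp (\<theta> - pi / 4)" by auto
qed

text \<open>At the left end, cosine and minus sine of \<open>- (pi / 4)\<close> are both
  \<open>sqrt 2 / 2\<close>. Matching with the exponential fixes the factor
  \<open>exp (\<tau> - pi / 2)\<close>.\<close>

lemma profile_end:
  assumes "\<tau> - pi / 4 \<le> \<theta>"
  shows "profile \<tau> \<theta> = exp (\<tau> - pi / 2) * cos (\<theta> - \<tau>)"
    and "profile' \<tau> \<theta> = - (exp (\<tau> - pi / 2) * sin (\<theta> - \<tau>))"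
proof -
  have "profile \<tau> \<theta> = exp (\<tau> - pi / 2) * cos (\<theta> - \<tau>) \<and>
      profile' \<tau> \<theta> = - (exp (\<tau> - pi / 2) * sin (\<theta> - \<tau>))"
  proof (cases "\<theta> = \<tau> - pi / 4")
    case True
    then have "pi / 4 \<le> \<theta>" "\<theta> \<le> \<tau> - pi / 4" "\<theta> - \<tau> = - (pi / 4)" "\<theta> - pi / 4 = \<tau> - pi / 2"
      using \<tau> by auto
    then show ?thesis
      by (simp only: profile_mid) (simp add: sin_45 cos_45)
  next
    case False
    then show ?thesis using assms \<tau> by (simp add: profile_def profile'_def)
  qed
  then show "profile \<tau> \<theta> = exp (\<tau> - pi / 2) * cos (\<theta> - \<tau>)"
    "profile' \<tau> \<theta> = - (exp (\<tau> - pi / 2) * sin (\<theta> - \<tau>))" by auto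
qed

lemma profile_deriv: "(profile \<tau> has_real_derivative profile' \<tau> \<theta>) (at \<theta>)"
proof -
  define f where "f \<theta> = (if \<theta> \<le> \<tau> - pi / 4 then sqrt 2 / 2 * exp (\<theta> - pi / 4)
      else exp (\<tau> - pi / 2) * cos (\<theta> - \<tau>))" for \<theta>
  define f' where "f' \<theta> = (if \<theta> \<le> \<tau> - pi / 4 then sqrt 2 / 2 * exp (\<theta> - pi / 4)
      else - (exp (\<tau> - pi / 2) * sin (\<theta> - \<tau>)))" for \<theta>
  have e: "((\<lambda>\<theta>. k * exp (\<theta> - b)) has_real_derivative k * exp (\<theta> - b)) (at \<theta>)"
    and c: "((\<lambda>\<theta>. k * cos (\<theta> - b)) has_real_derivative - (k * sin (\<theta> - b))) (at \<theta>)"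
    for k b \<theta> :: real by (rule derivative_eq_intros refl | simp)+
  have angles: "\<tau> - pi / 4 - pi / 4 = \<tau> - pi / 2" "\<tau> - pi / 4 - \<tau> = - (pi / 4)" by auto
  have f: "(f has_real_derivative f' \<theta>) (at \<theta>)" for \<theta>
    unfolding f_def f'_def
    by (rule has_real_derivative_glue[OF e c]) (simp_all only: angles, simp_all add: sin_45 cos_45)
  have "((\<lambda>\<theta>. if \<theta> \<le> pi / 4 then sin \<theta> else f \<theta>) has_real_derivative
      (if \<theta> \<le> pi / 4 then cos \<theta> else f' \<theta>)) (at \<theta>)"
    using \<tau> by (intro has_real_derivative_glue[OF DERIV_sin f]) (auto simp: f_def f'_def sin_45 cos_45)
  moreover have "profile \<tau> = (\<lambda>\<theta>. if \<theta> \<le> pi / 4 then sin \<theta> else f \<theta>)"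
    by (intro ext) (simp only: profile_def f_def)
  moreover have "profile' \<tau> \<theta> = (if \<theta> \<le> pi / 4 then cos \<theta> else f' \<theta>)"
    by (simp only: profile'_def f'_def)
  ultimately show ?thesis by simp
qed

lemma profile'_continuous: "continuous_on UNIV (profile' \<tau>)"
  unfolding profile'_def[abs_def]
proof (rule continuous_on_cases_1)
  show "continuous_on {\<theta> \<in> UNIV. pi / 4 \<le> \<theta>} (\<lambda>\<theta>. if \<theta> \<le> \<tau> - pi / 4
      then sqrt 2 / 2 * exp (\<theta> - pi / 4) else - (exp (\<tau> - pi / 2) * sin (\<theta> - \<tau>)))"
  proof (rule continuous_on_cases_1)
    have angles: "\<tau> - pi / 4 - pi / 4 = \<tau> - pi / 2" "\<tau> - pi / 4 - \<tau> = - (pi / 4)" by auto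
    show "sqrt 2 / 2 * exp (\<tau> - pi / 4 - pi / 4) = - (exp (\<tau> - pi / 2) * sin (\<tau> - pi / 4 - \<tau>))"
      unfolding angles by (simp add: sin_45)
  qed (intro continuous_intros)+
qed (use \<tau> in \<open>auto intro!: continuous_intros simp: cos_45\<close>)

end

text \<open>On every piece of the test function the integrand is at most a constant times one cosine
  with explicit primitive; \<open>c = 0\<close> covers the exponential piece.\<close>

lemma integral_le_cos:
  fixes \<phi> :: "real \<Rightarrow> real"
  assumes "l \<le> r" "continuous_on {l..r} \<phi>"
    and "\<And>t. t \<in> {l..r} \<Longrightarrow> \<phi> t \<le> c * (2 * p * cos (2 * p * (t - s)))"
  shows "integral {l..r} \<phi> \<le> c * (sin (2 * p * (r - s)) - sin (2 * p * (l - s)))"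
proof -
  have "((\<lambda>t. c * (2 * p * cos (2 * p * (t - s)))) has_integral
      c * sin (2 * p * (r - s)) - c * sin (2 * p * (l - s))) {l..r}"
    by (rule fundamental_theorem_of_calculus[OF assms(1)])
      (auto intro!: derivative_eq_intros simp: has_real_derivative_iff_has_vector_derivative[symmetric])
  moreover have "(\<phi> has_integral integral {l..r} \<phi>) {l..r}"
    by (intro integrable_integral integrable_continuous_real assms)
  ultimately have "integral {l..r} \<phi> \<le> c * sin (2 * p * (r - s)) - c * sin (2 * p * (l - s))"
    using has_integral_le assms(3) by blast
  then show ?thesis by (simp add: right_diff_distrib)
qed

section \<open>Decay of the orbits and the final bound\<close>

lemma (in m_accretive_operator) norm_S_antimono:
  assumes "0 \<le> s" "s \<le> t"
  shows "norm (S t x) \<le> norm (S s x)"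
  using S_semigroup[of "t - s" s x] norm_S_le[of "t - s" "S s x"] assms by simp

lemma (in m_accretive_operator) semigroup_decay:
  assumes "p > 0"
    and gap: "\<And>f s. f \<in> D \<Longrightarrow> p * norm f \<le> norm (H f - (\<i> * complex_of_real s) *\<^sub>C f)"
    and x: "x \<in> D" and T: "pi / 2 \<le> p * T"
  shows "norm (S T x) \<le> exp (- T * p + pi / 2) * norm x"
proof -
  \<comment> \<open>The time in which the phase \<open>p * t\<close> advances by
    \<open>pi / 4\<close>. The assumption on \<open>T\<close> becomes T >= 2a, so [a, T - a] is at
    worst a single point.\<close>
  define a where "a = pi / (4 * p)"
  have pa: "p * a = pi / 4" and "a > 0" using \<open>p > 0\<close> by (auto simp: a_def)
  have p_le: "p * s \<le> p * t \<longleftrightarrow> s \<le> t" for s t using \<open>p > 0\<close> by simp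
  have "p * a \<le> p * (T - a)" using T pa unfolding right_diff_distrib by linarith
  then have aT: "a \<le> T - a" using p_le by simp
  define M where "M = T + 2 * a"
  define C where "C = exp (p * T - pi / 2)"
  define h where "h t = (norm (S t x))\<^sup>2" for t
  have h_antimono: "h t \<le> h s" if "0 \<le> s" "s \<le> t" for s t
    unfolding h_def by (intro power_mono norm_S_antimono that) simp
  define \<psi> where "\<psi> t = profile (p * T) (p * t)" for t
  define \<psi>' where "\<psi>' t = profile' (p * T) (p * t) * p" for t
  define \<phi> where "\<phi> t = ((\<psi>' t)\<^sup>2 - p\<^sup>2 * (\<psi> t)\<^sup>2) * h t" for t
  have \<psi>_deriv: "(\<psi> has_real_derivative \<psi>' t) (at t within A)" for t A
    unfolding \<psi>_def \<psi>'_def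
    by (rule DERIV_chain2[OF profile_deriv[OF T]]) (auto intro!: derivative_eq_intros)
  have \<psi>'_cont: "continuous_on A \<psi>'" for A
    unfolding \<psi>'_def
    by (intro continuous_intros continuous_on_compose2[OF profile'_continuous[OF T]]) auto
  have \<psi>_cont: "continuous_on A \<psi>" for A
    using \<psi>_deriv by (rule DERIV_continuous_on)
  have \<phi>_cont: "continuous_on A \<phi>" if "A \<subseteq> {0..}" for A
    unfolding \<phi>_def h_def
    by (intro continuous_intros \<psi>_cont \<psi>'_cont continuous_on_subset[OF S_continuous that])
  have M: "p * M - p * T = pi / 2" "p * T - pi / 4 \<le> p * M"
  proof -
    have "p * M = p * T + 2 * (p * a)" by (simp add: M_def distrib_left)
    then show "p * M - p * T = pi / 2" "p * T - pi / 4 \<le> p * M" using pa pi_gt_zero by linarith+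
  qed
  have "0 \<le> integral {0..M} \<phi>"
    unfolding \<phi>_def h_def
  proof (rule gap_integral_estimate[OF less_imp_le[OF \<open>p > 0\<close>] gap x])
    show "\<psi> 0 = 0" using pi_gt_zero by (simp add: \<psi>_def profile_def)
    show "\<psi> M = 0" unfolding \<psi>_def profile_end[OF T M(2)] M(1) by simp
    show "M > 0" using aT \<open>a > 0\<close> by (simp add: M_def)
  qed (assumption | rule \<psi>_deriv \<psi>'_cont)+
  also have "\<dots> = integral {0..a} \<phi> + integral {a..T - a} \<phi> + integral {T - a..T} \<phi> + integral {T..M} \<phi>"
  proof -
    have "\<phi> integrable_on {0..t}" for t by (intro integrable_continuous_real \<phi>_cont) auto
    then show ?thesis
      using Henstock_Kurzweil_Integration.integral_combine[where a=0 and c=T and b=M and f=\<phi>]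
        Henstock_Kurzweil_Integration.integral_combine[where a=0 and c="T - a" and b=T and f=\<phi>]
        Henstock_Kurzweil_Integration.integral_combine[where a=0 and c=a and b="T - a" and f=\<phi>] aT \<open>a > 0\<close> by (simp add: M_def)
  qed
  finally have total: "0 \<le> integral {0..a} \<phi> + integral {a..T - a} \<phi> + integral {T - a..T} \<phi> + integral {T..M} \<phi>" .
  have I1: "integral {0..a} \<phi> \<le> (p * h 0 / 2) * (sin (2 * p * (a - 0)) - sin (2 * p * (0 - 0)))"
  proof (rule integral_le_cos)
    fix t assume t: "t \<in> {0..a}"
    then have pt: "0 \<le> p * t" "p * t \<le> pi / 4" using p_le[of t a] pa \<open>p > 0\<close> by auto
    have "\<phi> t = p\<^sup>2 * cos (2 * (p * t)) * h t"
      unfolding cos_double using pt(2)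
      by (simp add: \<phi>_def \<psi>_def \<psi>'_def profile_def profile'_def power_mult_distrib algebra_simps)
    also have "\<dots> \<le> p\<^sup>2 * cos (2 * (p * t)) * h 0"
      using pt t by (intro mult_left_mono h_antimono mult_nonneg_nonneg cos_ge_zero) auto
    finally show "\<phi> t \<le> p * h 0 / 2 * (2 * p * cos (2 * p * (t - 0)))"
      by (simp add: power2_eq_square mult_ac)
  qed (use \<open>a > 0\<close> \<phi>_cont in auto)
  have I2: "integral {a..T - a} \<phi> \<le> 0 * (sin (2 * p * (T - a - 0)) - sin (2 * p * (a - 0)))"
  proof (rule integral_le_cos)
    fix t assume t: "t \<in> {a..T - a}"
    then have "pi / 4 \<le> p * t" "p * t \<le> p * T - pi / 4"
      using p_le[of a t] p_le[of t "T - a"] pa by (auto simp: right_diff_distrib)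
    then have "\<phi> t = 0"
      by (simp add: \<phi>_def \<psi>_def \<psi>'_def profile_mid[OF T] power_mult_distrib power_divide)
    then show "\<phi> t \<le> 0 * (2 * p * cos (2 * p * (t - 0)))" by simp
  qed (use aT \<open>a > 0\<close> \<phi>_cont in auto)
  \<comment> \<open>The cosine is nonnegative here as on the first piece. There the upper bound
    froze \<open>h\<close> at its largest value, on the left; the minus sign now calls for the
    smallest, on the right.\<close>
  have I3: "integral {T - a..T} \<phi>
      \<le> (- (p * C\<^sup>2 * h T / 2)) * (sin (2 * p * (T - T)) - sin (2 * p * (T - a - T)))"
  proof (rule integral_le_cos)
    fix t assume t: "t \<in> {T - a..T}"
    then have pt: "p * T - pi / 4 \<le> p * t" "p * t \<le> p * T"
      using p_le[of "T - a" t] p_le[of t T] pa by (auto simp: right_diff_distrib)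
    have "\<phi> t = - (p\<^sup>2 * C\<^sup>2 * cos (2 * (p * t - p * T)) * h t)"
      unfolding \<phi>_def \<psi>_def \<psi>'_def profile_end[OF T pt(1)] C_def[symmetric] cos_double
      by (simp add: power_mult_distrib algebra_simps)
    also have "\<dots> \<le> - (p\<^sup>2 * C\<^sup>2 * cos (2 * (p * t - p * T)) * h T)"
      using pt t aT \<open>a > 0\<close>
      by (intro le_imp_neg_le mult_left_mono h_antimono mult_nonneg_nonneg cos_ge_zero) auto
    finally show "\<phi> t \<le> - (p * C\<^sup>2 * h T / 2) * (2 * p * cos (2 * p * (t - T)))"
      by (simp add: power2_eq_square mult_ac right_diff_distrib)
  qed (use aT \<open>a > 0\<close> \<phi>_cont in auto)
  have I4: "integral {T..M} \<phi>
      \<le> (- (p * C\<^sup>2 * h (T + a) / 2)) * (sin (2 * p * (M - T)) - sin (2 * p * (T - T)))"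
  proof (rule integral_le_cos)
    fix t assume t: "t \<in> {T..M}"
    then have pt: "p * T \<le> p * t" "p * t \<le> p * M" using p_le by auto
    have "\<phi> t = - (p\<^sup>2 * C\<^sup>2 * (cos (2 * (p * t - p * T)) * h t))"
    proof -
      have "p * T - pi / 4 \<le> p * t" using pt(1) pi_gt_zero by linarith
      from profile_end[OF T this] show ?thesis
        unfolding \<phi>_def \<psi>_def \<psi>'_def C_def[symmetric] cos_double
        by (simp add: power_mult_distrib algebra_simps)
    qed
    also have "\<dots> \<le> - (p\<^sup>2 * C\<^sup>2 * (cos (2 * (p * t - p * T)) * h (T + a)))"
    proof (rule le_imp_neg_le, rule mult_left_mono)
      have Ta: "p * (T + a) = p * T + pi / 4" by (simp add: distrib_left pa)
      show "cos (2 * (p * t - p * T)) * h (T + a) \<le> cos (2 * (p * t - p * T)) * h t"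
      proof (cases "t \<le> T + a")
        case True
        then have "p * t - p * T \<le> pi / 4" using p_le[of t "T + a"] Ta by simp
        then show ?thesis using True t pt aT \<open>a > 0\<close>
          by (intro mult_left_mono h_antimono cos_ge_zero) auto
      next
        case False
        then have "pi / 4 \<le> p * t - p * T" using p_le[of "T + a" t] Ta by simp
        then have "0 \<le> cos (pi - 2 * (p * t - p * T))" using pt(2) M(1) by (intro cos_ge_zero) auto
        then have "cos (2 * (p * t - p * T)) \<le> 0" by simp
        then show ?thesis using False aT \<open>a > 0\<close>
          by (intro mult_left_mono_neg h_antimono) auto
      qed
    qed auto
    finally show "\<phi> t \<le> - (p * C\<^sup>2 * h (T + a) / 2) * (2 * p * cos (2 * p * (t - T)))"
      by (simp add: power2_eq_square mult_ac right_diff_distrib)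
  qed (use aT \<open>a > 0\<close> \<phi>_cont in \<open>auto simp: M_def\<close>)
  have angles: "2 * p * (a - 0) = pi / 2" "2 * p * (T - a - T) = - (pi / 2)" "2 * p * (M - T) = pi"
    using pa by (auto simp: M_def algebra_simps)
  have "integral {0..a} \<phi> \<le> p * h 0 / 2" using I1 unfolding angles by simp
  moreover have "integral {a..T - a} \<phi> \<le> 0" using I2 by simp
  moreover have "integral {T - a..T} \<phi> \<le> - (p * C\<^sup>2 * h T / 2)" using I3 unfolding angles by simp
  moreover have "integral {T..M} \<phi> \<le> 0" using I4 unfolding angles by simp
  ultimately have "p * C\<^sup>2 * h T / 2 \<le> p * h 0 / 2" using total by linarith
  then have "p * (C\<^sup>2 * h T) \<le> p * h 0" by (simp add: mult.assoc)
  then have "C\<^sup>2 * h T \<le> h 0" using \<open>p > 0\<close> by simp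
  then have "(C * norm (S T x))\<^sup>2 \<le> (norm x)\<^sup>2" by (simp add: h_def S_zero power_mult_distrib)
  then have "C * norm (S T x) \<le> norm x" by (rule power2_le_imp_le) simp
  moreover have "exp (- T * p + pi / 2) * C = 1"
    by (simp add: C_def mult_exp_exp mult.commute)
  ultimately show ?thesis
    using mult_left_mono[of "C * norm (S T x)" "norm x" "exp (- T * p + pi / 2)"]
    by (simp add: mult.assoc[symmetric])
qed

text \<open>Both sides are homogeneous of degree one in \<open>f\<close>. At \<open>f = 0\<close>
  they vanish, so the claim also holds in the zero space, where \<open>Psi\<close> is the infimum of
  the empty set.\<close>

lemma (in m_accretive_operator) Psi_gap:
  assumes "f \<in> D"
  shows "Psi D H * norm f \<le> norm (H f - (\<i> * complex_of_real s) *\<^sub>C f)"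
proof (cases "f = 0")
  case False
  define g where "g = (1 / norm f) *\<^sub>R f"
  have "bdd_below {norm (H f - (\<i> * complex_of_real s) *\<^sub>C f) | f s. f \<in> D \<and> norm f = 1}"
    by (rule bdd_belowI[of _ 0]) auto
  moreover have "g \<in> D" "norm g = 1" using assms False by (auto simp: g_def scaleR_D)
  ultimately have "Psi D H \<le> norm (H g - (\<i> * complex_of_real s) *\<^sub>C g)"
    unfolding Psi_def by (intro cInf_lower) auto
  also have "H g - (\<i> * complex_of_real s) *\<^sub>C g = (1 / norm f) *\<^sub>R (H f - (\<i> * complex_of_real s) *\<^sub>C f)"
    by (simp only: g_def H_scaleR[OF assms] scaleC_scaleR scaleR_diff_right)
  also have "norm \<dots> = norm (H f - (\<i> * complex_of_real s) *\<^sub>C f) / norm f" by simp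
  finally show ?thesis using False by (simp add: pos_le_divide_eq)
qed simp

theorem theorem1p3:
  fixes D :: "'a::complex_hilbert set" and H :: "'a \<Rightarrow> 'a"
  assumes "m_accretive D H"
  shows "\<forall>t\<ge>0. onorm (exp_semigroup D H t) \<le> exp (- t * Psi D H + pi / 2)"
proof (intro allI impI)
  fix t :: real assume t: "t \<ge> 0"
  interpret m_accretive_operator D H by unfold_locales (rule assms)
  define K where "K = exp (- t * Psi D H + pi / 2)"
  have on_D: "norm (S t x) \<le> K * norm x" if x: "x \<in> D" for x
  \<comment> \<open>Unless both conditions hold, the bound \<open>K\<close> is at least 1.
    Nonpositive values of \<open>Psi\<close> thus fall under contractivity.\<close>
  proof (cases "Psi D H > 0 \<and> pi / 2 \<le> Psi D H * t")
    case True
    then show ?thesis unfolding K_def using semigroup_decay[OF _ Psi_gap x] by blast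
  next
    case False
    have "t * Psi D H \<le> pi / 2"
    proof (cases "Psi D H > 0")
      case False
      then have "t * Psi D H \<le> 0" using t by (intro mult_nonneg_nonpos) auto
      then show ?thesis using pi_gt_zero by linarith
    qed (use False in \<open>simp add: mult.commute\<close>)
    then have "1 \<le> K" by (simp add: K_def)
    then have "norm x \<le> K * norm x" using mult_right_mono[of 1 K "norm x"] by simp
    then show ?thesis using norm_S_le[OF t, of x] by linarith
  qed
  \<comment> \<open>The gap estimate needed differentiable orbits. The resulting bound is a closed
    condition and extends from the dense domain to the whole space.\<close>
  have "continuous_on UNIV (S t)"
    using bounded_clinear_S[OF t] by (simp add: bounded_clinear_def linear_continuous_on)
  then have "closed {x. norm (S t x) \<le> K * norm x}"
    by (intro closed_Collect_le continuous_intros)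
  then have "norm (S t x) \<le> K * norm x" for x
    using dense_extend[of "\<lambda>x. norm (S t x) \<le> K * norm x"] on_D by blast
  then have "onorm (S t) \<le> K" by (intro onorm_bound) (auto simp: K_def)
  then show "onorm (exp_semigroup D H t) \<le> exp (- t * Psi D H + pi / 2)"
    by (simp add: exp_semigroup_eq[OF t] K_def)
qed

end
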